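(* Let $n\ge 2$ and let $M\subset\mathbb{C}^{n+1}$ be a connected, oriented, smooth embedded real hypersurface (real dimension $2n+1$) which is Levi umbilical and whose Levi curvature $H$ is a non-zero constant. Then $M$ is contained either in a sphere of $\mathbb{C}^{n+1}$ or in the boundary of a spherical tube.
   Context: Setting. $J$ is the standard complex structure of $\mathbb{C}^{n+1}$ and $D$ is the standard flat connection, extended complex-linearly to complex vector fields. $g$ is the $\mathbb{C}$-bilinear extension of the Euclidean metric of $\mathbb{C}^{n+1}=\mathbb{R}^{2n+2}$ to complexified tangent vectors, so that $g(\partial_{z_h},\partial_{\bar z_k})=\tfrac12\delta_{hk}$ and $g(\partial_{z_h},\partial_{z_k})=g(\partial_{\bar z_h},\partial_{\bar z_k})=0$. $M$ is oriented by a smooth real unit normal $\nu$. $\mathcal{H}=T^{1,0}M$ is the holomorphic tangent bundle of $M$, i.e. $\mathcal{H}=T^{1,0}\mathbb{C}^{n+1}\cap \mathbb{C}TM$, where $\mathbb{C}TM$ is the complexified tangent bundle; it has complex rank $n$. The second fundamental form of $M$, extended $\mathbb{C}$-bilinearly to $\mathbb{C}TM$, is $h(Z,W)=g(Z,D_W\nu)$. The Levi form is the hermitian form $(Z,W)\mapsto h(Z,\bar W)$ on $\mathcal{H}$. The Levi curvature is its normalized trace $H=\frac1n\sum_{\alpha,\beta=1}^n g^{\alpha\bar\beta}h(Z_\alpha,\bar Z_\beta)$, where $Z_1,\dots,Z_n$ is any local frame of $\mathcal{H}$, $g_{\alpha\bar\beta}=g(Z_\alpha,\bar Z_\beta)$,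 and $g^{\alpha\bar\beta}$ is determined by $\sum_\beta g^{\alpha\bar\beta}g_{\gamma\bar\beta}=\delta_{\alpha\gamma}$. $M$ is Levi umbilical if $h(Z,\bar W)=H\,g(Z,\bar W)$ for all $Z,W\in\mathcal{H}$. "The boundary of a spherical tube" means the image, under a complex isometry of $\mathbb{C}^{n+1}$ (a map $z\mapsto Uz+b$ with $U$ unitary and $b\in\mathbb{C}^{n+1}$), of a set $\{z\in\mathbb{C}^{n+1}:\sum_{h=1}^{n+1}(z_h+\bar z_h)^2=r^2\}$ with $r>0$. Spheres may have any center and any positive radius. *)

theory Defs
  imports "HOL-Analysis.Analysis"
begin

fun k_smooth_on :: "nat \<Rightarrow> 'a::real_normed_vector set \<Rightarrow> ('a \<Rightarrow> 'b::real_normed_vector) \<Rightarrow> bool" where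
  "k_smooth_on 0 U f \<longleftrightarrow> continuous_on U f"
| "k_smooth_on (Suc k) U f \<longleftrightarrow>
     (\<forall>x\<in>U. f differentiable (at x)) \<and>
     (\<forall>v. k_smooth_on k U (\<lambda>x. frechet_derivative f (at x) v))"

text \<open>Meant for open sets in finite-dimensional spaces, where testing the derivative on each
  fixed vector gives the usual class of infinitely differentiable maps.\<close>

definition smooth_on :: "'a::real_normed_vector set \<Rightarrow> ('a \<Rightarrow> 'b::real_normed_vector) \<Rightarrow> bool" where
  "smooth_on U f \<longleftrightarrow> (\<forall>k. k_smooth_on k U f)"

definition smooth_along :: "'a::real_normed_vector set \<Rightarrow> ('a \<Rightarrow> 'b::real_normed_vector) \<Rightarrow> bool" where
  "smooth_along M f \<longleftrightarrow>
     (\<forall>p\<in>M. \<exists>U F. open U \<and> p \<in> U \<and> smooth_on U F \<and> (\<forall>x\<in>U \<inter> M. F x = f x))"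

definition embedded_hypersurface :: "'a::euclidean_space set \<Rightarrow> bool" where
  "embedded_hypersurface M \<longleftrightarrow>
     (\<forall>p\<in>M. \<exists>U. \<exists>\<rho>::'a \<Rightarrow> real. open U \<and> p \<in> U \<and> smooth_on U \<rho> \<and>
        M \<inter> U = {x \<in> U. \<rho> x = 0} \<and>
        (\<forall>x\<in>M \<inter> U. frechet_derivative \<rho> (at x) \<noteq> (\<lambda>_. 0)))"

definition tangent_space :: "'a::euclidean_space set \<Rightarrow> 'a \<Rightarrow> 'a set" where
  "tangent_space M p =
     {X. \<exists>\<epsilon>>0. \<exists>\<gamma>::real \<Rightarrow> 'a. smooth_on {-\<epsilon><..<\<epsilon>} \<gamma> \<and> \<gamma> ` {-\<epsilon><..<\<epsilon>} \<subseteq> M \<and>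
           \<gamma> 0 = p \<and> (\<gamma> has_vector_derivative X) (at 0)}"

definition smooth_unit_normal :: "'a::euclidean_space set \<Rightarrow> ('a \<Rightarrow> 'a) \<Rightarrow> bool" where
  "smooth_unit_normal M \<nu> \<longleftrightarrow>
     smooth_along M \<nu> \<and>
     (\<forall>p\<in>M. norm (\<nu> p) = 1 \<and> (\<forall>X\<in>tangent_space M p. \<nu> p \<bullet> X = 0))"

text \<open>The pair \<open>(X, Y)\<close> stands for the complexified tangent vector \<open>X + i Y\<close>, with \<open>X\<close>, \<open>Y\<close> real
  tangent vectors of complex Euclidean space; this \<open>i\<close> is distinct from the complex structure
  \<open>J\<close>.\<close>

type_synonym 'm cvec = "(complex ^ 'm) \<times> (complex ^ 'm)"

definition cscale :: "complex \<Rightarrow> 'm::finite cvec \<Rightarrow> 'm cvec" where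
  "cscale c Z = (Re c *\<^sub>R fst Z - Im c *\<^sub>R snd Z, Im c *\<^sub>R fst Z + Re c *\<^sub>R snd Z)"

definition cvec_cnj :: "'m::finite cvec \<Rightarrow> 'm cvec" where
  "cvec_cnj Z = (fst Z, - snd Z)"

definition cplx_J :: "'m::finite cvec \<Rightarrow> 'm cvec" where
  "cplx_J Z = (\<i> *s fst Z, \<i> *s snd Z)"

text \<open>Complex-bilinear extension of the Euclidean inner product.\<close>

definition cmetric :: "'m::finite cvec \<Rightarrow> 'm cvec \<Rightarrow> complex" where
  "cmetric Z W = Complex (fst Z \<bullet> fst W - snd Z \<bullet> snd W) (fst Z \<bullet> snd W + snd Z \<bullet> fst W)"

definition d_z :: "'m \<Rightarrow> 'm::finite cvec" where
  "d_z h = (axis h (1 / 2), axis h (- \<i> / 2))"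

lemma cmetric_d_z:
  "cmetric (d_z h) (cvec_cnj (d_z k)) = (if h = k then 1 / 2 else 0)"
  "cmetric (d_z h) (d_z k) = 0"
  "cmetric (cvec_cnj (d_z h)) (cvec_cnj (d_z k)) = 0"
  by (auto simp: cmetric_def d_z_def cvec_cnj_def inner_axis_axis inner_complex_def complex_eq_iff)

definition holo_tangent :: "(complex ^ 'm::finite) set \<Rightarrow> complex ^ 'm \<Rightarrow> 'm cvec set" where
  "holo_tangent M p =
     {Z. cplx_J Z = cscale \<i> Z \<and> fst Z \<in> tangent_space M p \<and> snd Z \<in> tangent_space M p}"

text \<open>The derivative within \<open>M\<close> is not unique in directions normal to \<open>M\<close>, but
  its value on tangent vectors is, as the lemma below shows.\<close>

definition D_along :: "(complex ^ 'm::finite) set \<Rightarrow> (complex ^ 'm \<Rightarrow> complex ^ 'm) \<Rightarrow>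
    complex ^ 'm \<Rightarrow> 'm cvec \<Rightarrow> 'm cvec" where
  "D_along M \<nu> p W =
     (frechet_derivative \<nu> (at p within M) (fst W), frechet_derivative \<nu> (at p within M) (snd W))"

lemma frechet_derivative_within_tangent:
  assumes F: "(F has_derivative F') (at p)" and U: "open U" "p \<in> U"
    and eq: "\<forall>x\<in>U \<inter> M. F x = f x" and X: "X \<in> tangent_space M p"
  shows "frechet_derivative f (at p within M) X = F' X"
proof -
  obtain \<epsilon> \<gamma> where e: "\<epsilon> > 0" "\<gamma> ` {-\<epsilon><..<\<epsilon>} \<subseteq> M" "\<gamma> 0 = p"
    and g: "(\<gamma> has_vector_derivative X) (at 0)"
    using X by (auto simp: tangent_space_def)
  let ?S = "{-\<epsilon><..<\<epsilon>}"
  have pM: "p \<in> M" using e by force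
  obtain d where d: "d > 0" "ball p d \<subseteq> U"
    using U by (meson open_contains_ball)
  have fM: "(f has_derivative F') (at p within M)"
    by (rule has_derivative_transform_within[OF has_derivative_at_withinI[OF F] d(1) pM])
      (use d eq in \<open>auto simp: subset_eq dist_commute\<close>)
  then have "(f has_derivative frechet_derivative f (at p within M)) (at p within M)"
    by (meson differentiable_def frechet_derivative_works)
  then have f: "(f has_derivative frechet_derivative f (at p within M)) (at (\<gamma> 0) within \<gamma> ` ?S)"
    using e by (auto intro: has_derivative_subset)
  have fF: "(f has_derivative F') (at (\<gamma> 0) within \<gamma> ` ?S)"
    using fM e by (auto intro: has_derivative_subset)
  have gS: "(\<gamma> has_vector_derivative X) (at 0 within ?S)"
    using g by (rule has_vector_derivative_at_within)
  have "(f \<circ> \<gamma> has_vector_derivative frechet_derivative f (at p within M) X) (at 0 within ?S)"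
    "(f \<circ> \<gamma> has_vector_derivative F' X) (at 0 within ?S)"
    using vector_derivative_diff_chain_within[OF gS f] vector_derivative_diff_chain_within[OF gS fF]
    by auto
  moreover have "at 0 within ?S = at (0::real)"
    using e by (intro at_within_open) auto
  ultimately show ?thesis
    by (metis vector_derivative_unique_at)
qed

definition second_fundamental_form :: "(complex ^ 'm::finite) set \<Rightarrow> (complex ^ 'm \<Rightarrow> complex ^ 'm) \<Rightarrow>
    complex ^ 'm \<Rightarrow> 'm cvec \<Rightarrow> 'm cvec \<Rightarrow> complex" where
  "second_fundamental_form M \<nu> p Z W = cmetric Z (D_along M \<nu> p W)"

definition levi_form :: "(complex ^ 'm::finite) set \<Rightarrow> (complex ^ 'm \<Rightarrow> complex ^ 'm) \<Rightarrow>
    complex ^ 'm \<Rightarrow> 'm cvec \<Rightarrow> 'm cvec \<Rightarrow> complex" where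
  "levi_form M \<nu> p Z W = second_fundamental_form M \<nu> p Z (cvec_cnj W)"

text \<open>Value at \<open>p\<close> of a local frame, i.e. a complex basis of the fibre. In the next two
  definitions the number \<open>CARD('m) - 1\<close> is \<open>n\<close>, the complex rank of the holomorphic tangent
  bundle.\<close>

definition holo_frame_at :: "(complex ^ 'm::finite) set \<Rightarrow> complex ^ 'm \<Rightarrow> (nat \<Rightarrow> 'm cvec) \<Rightarrow> bool" where
  "holo_frame_at M p Z \<longleftrightarrow>
     (let n = CARD('m) - 1 in
        (\<forall>\<alpha><n. Z \<alpha> \<in> holo_tangent M p) \<and>
        (\<forall>W\<in>holo_tangent M p. \<exists>c. W = (\<Sum>\<alpha><n. cscale (c \<alpha>) (Z \<alpha>))) \<and>
        (\<forall>c. (\<Sum>\<alpha><n. cscale (c \<alpha>) (Z \<alpha>)) = 0 \<longrightarrow> (\<forall>\<alpha><n. c \<alpha> = 0)))"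

text \<open>The matrix \<open>G \<alpha> \<beta>\<close> is the inverse of the matrix of the metric in the frame \<open>Z\<close>. The value
  does not depend on the frame, which makes the definite description well-defined.\<close>

definition levi_curvature :: "(complex ^ 'm::finite) set \<Rightarrow> (complex ^ 'm \<Rightarrow> complex ^ 'm) \<Rightarrow>
    complex ^ 'm \<Rightarrow> complex" where
  "levi_curvature M \<nu> p =
     (let n = CARD('m) - 1 in
      THE H. \<exists>Z. \<exists>G :: nat \<Rightarrow> nat \<Rightarrow> complex.
        holo_frame_at M p Z \<and>
        (\<forall>\<alpha><n. \<forall>\<gamma><n. (\<Sum>\<beta><n. G \<alpha> \<beta> * cmetric (Z \<gamma>) (cvec_cnj (Z \<beta>))) = (if \<alpha> = \<gamma> then 1 else 0)) \<and>
        H = (1 / of_nat n) * (\<Sum>\<alpha><n. \<Sum>\<beta><n. G \<alpha> \<beta> * levi_form M \<nu> p (Z \<alpha>) (Z \<beta>)))"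

definition levi_umbilical :: "(complex ^ 'm::finite) set \<Rightarrow> (complex ^ 'm \<Rightarrow> complex ^ 'm) \<Rightarrow> bool" where
  "levi_umbilical M \<nu> \<longleftrightarrow>
     (\<forall>p\<in>M. \<forall>Z\<in>holo_tangent M p. \<forall>W\<in>holo_tangent M p.
        levi_form M \<nu> p Z W = levi_curvature M \<nu> p * cmetric Z (cvec_cnj W))"

definition unitary_matrix :: "complex ^ 'm ^ 'm::finite \<Rightarrow> bool" where
  "unitary_matrix U \<longleftrightarrow>
     U ** (\<chi> i j. cnj (U $ j $ i)) = mat 1 \<and> (\<chi> i j. cnj (U $ j $ i)) ** U = mat 1"

definition spherical_tube_boundary :: "(complex ^ 'm::finite) set \<Rightarrow> bool" where
  "spherical_tube_boundary T \<longleftrightarrow>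
     (\<exists>U b. \<exists>r>0. unitary_matrix U \<and>
        T = (\<lambda>z. U *v z + b) ` {z. (\<Sum>h\<in>UNIV. (z $ h + cnj (z $ h))\<^sup>2) = (complex_of_real r)\<^sup>2})"

end

theory Submission
  imports Defs
begin

text \<open>Near each point \<open>M\<close> has a defining function \<open>r\<close> whose gradient along \<open>M\<close> is \<open>\<nu>\<close>, so that the
  second fundamental form is the Hessian \<open>h\<close> of \<open>r\<close> and the Codazzi equations become the symmetry of
  the third derivative \<open>C\<close>. Put \<open>T = J \<nu>\<close> and let \<open>H\<close> be the orthogonal complement of \<open>\<nu>\<close> and \<open>T\<close>.
  Umbilicity says \<open>h (X, Y) + h (J X, J Y) = 2 c (X \<bullet> Y)\<close> on \<open>H\<close>. Differentiating it and using
  \<open>dim H \<ge> 4\<close> gives \<open>h (T, X) = 0\<close> on \<open>H\<close>; differentiating this in turn shows that the shape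
  operator \<open>A\<close> satisfies \<open>(A - c)\<^sup>2 = c (c - \<lambda>)\<close> on \<open>H\<close>, where \<open>\<lambda> = h (T, T)\<close> is constant on \<open>M\<close>.
  If \<open>\<lambda> = c\<close>, then \<open>A = c\<close> and \<open>\<nu> - c x\<close> is constant: \<open>M\<close> lies in a sphere. Otherwise \<open>C\<close> vanishes
  on \<open>H\<close>, and the symmetry of the fourth derivative (the Gauss equation) forces \<open>\<lambda> = 0\<close>. Then
  \<open>A / (2 c)\<close>, extended by \<open>\<nu> \<mapsto> \<nu>\<close>, is the projection \<open>P\<close> onto a totally real subspace that does not
  depend on the point, and \<open>\<nu> - 2 c P x\<close> is constant: \<open>M\<close> lies in the boundary of a tube.\<close>

section \<open>Smooth functions and symmetry of derivatives\<close>

text \<open>Umbilicity controls only half of the shape operator: it says that \<open>A - c\<close>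
  anticommutes with \<open>J\<close> on \<open>H\<close> and leaves this anticommuting part free.
  The rest has to be extracted from derivatives of the condition, where \<open>T\<close> enters
  because \<open>H\<close> itself turns as the point moves. To differentiate without a connection on
  \<open>M\<close>, a vector of \<open>H\<close> is extended by the pointwise projection of a
  constant field; the derivative of the extension lies in the span of \<open>\<nu>\<close> and
  \<open>T\<close>, which keeps the correction terms few. The value \<open>h (\<nu>, \<nu>)\<close>
  depends on the choice of \<open>r\<close> and has to cancel in the end. Two models explain the
  constants. With the outward normal, a sphere of radius \<open>R\<close> has
  \<open>A = 1 / R\<close> on all tangent vectors, so \<open>c = lam = 1 / R\<close>. The tube over
  the real sphere of radius \<open>R\<close> has \<open>A = 1 / R\<close> on real tangent directions
  and \<open>A = 0\<close> on imaginary ones, among them \<open>T\<close>; so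
  \<open>c = 1 / (2 R)\<close>, \<open>lam = 0\<close>, and \<open>2 c\<close> is the non-zero
  principal curvature.\<close>

abbreviation ddir :: "'a::real_normed_vector \<Rightarrow> ('a \<Rightarrow> 'b::real_normed_vector) \<Rightarrow> 'a \<Rightarrow> 'b" where
  "ddir v f \<equiv> (\<lambda>x. frechet_derivative f (at x) v)"

lemma ddir_eq: "(f has_derivative f') (at x) \<Longrightarrow> ddir v f x = f' v"
  by (metis frechet_derivative_at)

lemma has_derivative_ddir:
  "f differentiable at x \<Longrightarrow> (f has_derivative (\<lambda>v. ddir v f x)) (at x)"
  by (simp add: frechet_derivative_works)

text \<open>The rules of differentiation give formulas for \<open>ddir v f\<close> at points of
  \<open>U\<close> only; this lets the closure lemmas below replace the derivative by such a
  formula.\<close>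

lemma k_smooth_on_cong:
  assumes "open U" "\<And>x. x \<in> U \<Longrightarrow> f x = g x" "k_smooth_on k U f"
  shows "k_smooth_on k U g"
  using assms(2,3)
proof (induction k arbitrary: f g)
  case 0
  then show ?case by (simp cong: continuous_on_cong)
next
  case (Suc k)
  have d: "f differentiable at x" "frechet_derivative f (at x) = frechet_derivative g (at x)"
    if "x \<in> U" for x
    using Suc.prems that frechet_derivative_transform_within_open[OF _ assms(1) that, of f g] by auto
  have "g differentiable at x" if "x \<in> U" for x
    using d(1)[OF that] Suc.prems(1) \<open>open U\<close> that unfolding differentiable_def
    by (metis has_derivative_transform_within_open)
  moreover have "k_smooth_on k U (ddir v g)" for v
    by (rule Suc.IH[of "ddir v f"]) (use Suc.prems(2) d(2) in auto)
  ultimately show ?case by simp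
qed

lemma k_smooth_on_SucD: "k_smooth_on (Suc k) U f \<Longrightarrow> k_smooth_on k U f"
proof (induction k arbitrary: f)
  case 0
  then show ?case
    by (auto intro!: continuous_at_imp_continuous_on differentiable_imp_continuous_within)
next
  case (Suc k)
  then show ?case by (metis k_smooth_on.simps(2))
qed

lemma k_smooth_on_subset: "k_smooth_on k U f \<Longrightarrow> V \<subseteq> U \<Longrightarrow> k_smooth_on k V f"
  by (induction k arbitrary: f) (auto intro: continuous_on_subset)

lemma k_smooth_on_const [simp]: "k_smooth_on k U (\<lambda>_. a)"
  by (induction k arbitrary: a) auto

lemma k_smooth_on_bounded_linear:
  assumes "bounded_linear L" "k_smooth_on k U f" "open U"
  shows "k_smooth_on k U (\<lambda>x. L (f x))"
  using assms(2)
proof (induction k arbitrary: f)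
  case 0
  then show ?case using assms(1) by (simp add: bounded_linear.continuous_on)
next
  case (Suc k)
  have d: "((\<lambda>x. L (f x)) has_derivative (\<lambda>v. L (frechet_derivative f (at x) v))) (at x)"
    if "x \<in> U" for x
    using Suc.prems that by (intro bounded_linear.has_derivative[OF assms(1)] has_derivative_ddir) auto
  have "k_smooth_on k U (ddir v (\<lambda>x. L (f x)))" for v
    by (rule k_smooth_on_cong[OF assms(3) _ Suc.IH[of "ddir v f"]])
      (use Suc.prems in \<open>auto simp: ddir_eq[OF d]\<close>)
  with d show ?case by (auto simp: differentiable_def)
qed

lemma k_smooth_on_add:
  assumes "k_smooth_on k U f" "k_smooth_on k U g" "open U"
  shows "k_smooth_on k U (\<lambda>x. f x + g x)"
  using assms(1,2)
proof (induction k arbitrary: f g)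
  case 0
  then show ?case by (auto intro: continuous_intros)
next
  case (Suc k)
  have d: "((\<lambda>x. f x + g x) has_derivative
      (\<lambda>v. frechet_derivative f (at x) v + frechet_derivative g (at x) v)) (at x)"
    if "x \<in> U" for x
    using Suc.prems that by (intro has_derivative_add has_derivative_ddir) auto
  have "k_smooth_on k U (ddir v (\<lambda>x. f x + g x))" for v
    by (rule k_smooth_on_cong[OF assms(3) _ Suc.IH[of "ddir v f" "ddir v g"]])
      (use Suc.prems in \<open>auto simp: ddir_eq[OF d]\<close>)
  with d show ?case by (auto simp: differentiable_def)
qed

lemma k_smooth_on_bilinear:
  assumes "bounded_bilinear B" "k_smooth_on k U f" "k_smooth_on k U g" "open U"
  shows "k_smooth_on k U (\<lambda>x. B (f x) (g x))"
  using assms(2,3)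
proof (induction k arbitrary: f g)
  case 0
  then show ?case using assms(1) by (simp add: bounded_bilinear.continuous_on)
next
  case (Suc k)
  have d: "((\<lambda>x. B (f x) (g x)) has_derivative
      (\<lambda>v. B (f x) (frechet_derivative g (at x) v) + B (frechet_derivative f (at x) v) (g x))) (at x)"
    if "x \<in> U" for x
    using Suc.prems that
    by (intro bounded_bilinear.FDERIV[OF assms(1)] has_derivative_ddir) auto
  have "k_smooth_on k U (ddir v (\<lambda>x. B (f x) (g x)))" for v
  proof (rule k_smooth_on_cong[OF assms(4)])
    show "k_smooth_on k U (\<lambda>x. B (f x) (ddir v g x) + B (ddir v f x) (g x))"
      using Suc.prems k_smooth_on_SucD[OF Suc.prems(1)] k_smooth_on_SucD[OF Suc.prems(2)]
      by (intro k_smooth_on_add Suc.IH assms(4)) auto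
  qed (auto simp: ddir_eq[OF d])
  with d show ?case by (auto simp: differentiable_def)
qed

lemma k_smooth_on_sum:
  assumes "\<And>i. i \<in> I \<Longrightarrow> k_smooth_on k U (f i)" "open U"
  shows "k_smooth_on k U (\<lambda>x. \<Sum>i\<in>I. f i x)"
  using assms
  by (induction I rule: infinite_finite_induct) (auto intro!: k_smooth_on_add)

lemma k_smooth_on_inverse:
  fixes f :: "'a::real_normed_vector \<Rightarrow> real"
  assumes "k_smooth_on k U f" "open U" "\<And>x. x \<in> U \<Longrightarrow> f x \<noteq> 0"
  shows "k_smooth_on k U (\<lambda>x. inverse (f x))"
  using assms(1)
proof (induction k)
  case 0
  then show ?case using assms(3) by (auto intro!: continuous_intros)
next
  case (Suc k)
  have d: "((\<lambda>x. inverse (f x)) has_derivative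
      (\<lambda>v. - (inverse (f x) * frechet_derivative f (at x) v * inverse (f x)))) (at x)"
    if "x \<in> U" for x
    using Suc.prems that assms(3)[OF that]
    by (intro Deriv.has_derivative_inverse has_derivative_ddir) auto
  have i: "k_smooth_on k U (\<lambda>x. inverse (f x))"
    using Suc.IH Suc.prems k_smooth_on_SucD by blast
  have "k_smooth_on k U (ddir v (\<lambda>x. inverse (f x)))" for v
  proof (rule k_smooth_on_cong[OF assms(2)])
    show "k_smooth_on k U (\<lambda>x. - (inverse (f x) * ddir v f x * inverse (f x)))"
      using Suc.prems i
      by (intro k_smooth_on_bounded_linear[OF bounded_linear_minus[OF bounded_linear_ident]]
          k_smooth_on_bilinear[OF bounded_bilinear_mult] assms(2)) auto
  qed (auto simp: ddir_eq[OF d])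
  with d show ?case by (auto simp: differentiable_def)
qed

lemma linear_frechet_derivative_sum:
  fixes f :: "'a::euclidean_space \<Rightarrow> 'b::real_normed_vector"
  assumes "f differentiable at x"
  shows "frechet_derivative f (at x) v = (\<Sum>b\<in>Basis. (v \<bullet> b) *\<^sub>R frechet_derivative f (at x) b)"
proof -
  have l: "linear (frechet_derivative f (at x))"
    using assms by (rule linear_frechet_derivative)
  have "frechet_derivative f (at x) v = frechet_derivative f (at x) (\<Sum>b\<in>Basis. (v \<bullet> b) *\<^sub>R b)"
    by (simp add: euclidean_representation)
  then show ?thesis
    by (simp add: linear_sum[OF l] linear_cmul[OF l])
qed

text \<open>In the chain rule the direction in which \<open>f\<close> is differentiated varies with
  \<open>t\<close>; expanding it over \<open>Basis\<close> leaves sums of products. The order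
  \<open>k\<close> is asked of \<open>\<gamma>\<close> alone, so that the lemma can raise the
  smoothness of a curve whose velocity is a smooth function of its position.\<close>

lemma k_smooth_on_compose:
  fixes f :: "'a::euclidean_space \<Rightarrow> 'b::real_normed_vector"
  assumes "smooth_on U f" "k_smooth_on k I \<gamma>" "\<gamma> ` I \<subseteq> U" "open I" "open U"
  shows "k_smooth_on k I (\<lambda>t. f (\<gamma> t))"
  using assms(1,2)
proof (induction k arbitrary: f)
  case 0
  then have "continuous_on U f"
    unfolding smooth_on_def by (metis k_smooth_on.simps(1))
  with 0 assms(3) show ?case
    by (auto intro: continuous_on_compose2)
next
  case (Suc k)
  have f: "f differentiable at x" if "x \<in> U" for x
    using Suc.prems(1) that unfolding smooth_on_def by (metis k_smooth_on.simps(2))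
  have D: "smooth_on U (ddir b f)" for b
    using Suc.prems(1) unfolding smooth_on_def by (metis k_smooth_on.simps(2))
  have d: "((\<lambda>t. f (\<gamma> t)) has_derivative
      (\<lambda>v. frechet_derivative f (at (\<gamma> t)) (frechet_derivative \<gamma> (at t) v))) (at t)"
    if "t \<in> I" for t
  proof -
    have "(\<gamma> has_derivative frechet_derivative \<gamma> (at t)) (at t)"
      using Suc.prems(2) that by (intro has_derivative_ddir) auto
    moreover have "(f has_derivative frechet_derivative f (at (\<gamma> t))) (at (\<gamma> t))"
      using f that assms(3) by (intro has_derivative_ddir) auto
    ultimately show ?thesis
      using diff_chain_at by (force simp: o_def)
  qed
  have "k_smooth_on k I (ddir v (\<lambda>t. f (\<gamma> t)))" for v
  proof (rule k_smooth_on_cong[OF assms(4)])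
    show "k_smooth_on k I (\<lambda>t. \<Sum>b\<in>Basis. (ddir v \<gamma> t \<bullet> b) *\<^sub>R ddir b f (\<gamma> t))"
      using Suc.prems(2) k_smooth_on_SucD[OF Suc.prems(2)] D
      by (intro k_smooth_on_sum k_smooth_on_bilinear[OF bounded_bilinear_scaleR]
          k_smooth_on_bounded_linear[OF bounded_linear_inner_left] Suc.IH assms(4)) auto
  next
    fix t assume t: "t \<in> I"
    then have "\<gamma> t \<in> U" using assms(3) by auto
    then show "(\<Sum>b\<in>Basis. (ddir v \<gamma> t \<bullet> b) *\<^sub>R ddir b f (\<gamma> t)) = ddir v (\<lambda>t. f (\<gamma> t)) t"
      using linear_frechet_derivative_sum[OF f] d[OF t] by (simp add: ddir_eq)
  qed
  with d show ?case by (auto simp: differentiable_def)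
qed

lemma smooth_onD:
  assumes "smooth_on U f"
  shows "x \<in> U \<Longrightarrow> f differentiable at x" "smooth_on U (ddir v f)" "continuous_on U f"
  using assms unfolding smooth_on_def
  by (metis k_smooth_on.simps(2), metis k_smooth_on.simps(2), metis k_smooth_on.simps(1))

lemma smooth_on_subset: "smooth_on U f \<Longrightarrow> V \<subseteq> U \<Longrightarrow> smooth_on V f"
  by (auto simp: smooth_on_def intro: k_smooth_on_subset)

text \<open>The mean value theorem is applied to the second difference twice, first along
  \<open>u\<close> and then along \<open>v\<close>. The second difference is symmetric in
  \<open>u\<close> and \<open>v\<close>, so it can be compared with both mixed derivatives.\<close>

lemma ddir_swap_mvt:
  fixes f :: "'a::real_normed_vector \<Rightarrow> real"
  assumes f: "smooth_on U f" and t: "t > 0"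
    and box: "\<And>a b. 0 \<le> a \<Longrightarrow> a \<le> t \<Longrightarrow> 0 \<le> b \<Longrightarrow> b \<le> t \<Longrightarrow> x + a *\<^sub>R u + b *\<^sub>R v \<in> U"
  shows "\<exists>a b. 0 \<le> a \<and> a \<le> t \<and> 0 \<le> b \<and> b \<le> t \<and>
    f (x + t *\<^sub>R u + t *\<^sub>R v) - f (x + t *\<^sub>R u) - f (x + t *\<^sub>R v) + f x
      = t * t * ddir v (ddir u f) (x + a *\<^sub>R u + b *\<^sub>R v)"
proof -
  have line: "((\<lambda>s. F (y + s *\<^sub>R w)) has_real_derivative ddir w F (y + s *\<^sub>R w)) (at s)"
    if "smooth_on U F" "y + s *\<^sub>R w \<in> U" for F :: "'a \<Rightarrow> real" and y w s
  proof -
    have "(F has_derivative frechet_derivative F (at (y + s *\<^sub>R w))) (at (y + s *\<^sub>R w))"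
      using smooth_onD(1)[OF that] by (rule has_derivative_ddir)
    moreover have "((\<lambda>s. y + s *\<^sub>R w) has_vector_derivative w) (at s)"
      by (auto intro!: derivative_eq_intros simp: has_vector_derivative_def)
    ultimately have "((F \<circ> (\<lambda>s. y + s *\<^sub>R w)) has_vector_derivative ddir w F (y + s *\<^sub>R w)) (at s)"
      by (rule vector_derivative_diff_chain_within[rotated, OF has_derivative_at_withinI])
    then show ?thesis
      by (simp add: o_def has_real_derivative_iff_has_vector_derivative)
  qed
  let ?g = "\<lambda>s. f (x + t *\<^sub>R v + s *\<^sub>R u) - f (x + s *\<^sub>R u)"
  let ?g' = "\<lambda>s. ddir u f (x + t *\<^sub>R v + s *\<^sub>R u) - ddir u f (x + s *\<^sub>R u)"
  have "(?g has_real_derivative ?g' s) (at s)" if "0 \<le> s" "s \<le> t" for s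
  proof (intro DERIV_diff line[OF f])
    show "x + t *\<^sub>R v + s *\<^sub>R u \<in> U" "x + s *\<^sub>R u \<in> U"
      using box[of s t] box[of s 0] that t by (simp_all add: add_ac)
  qed
  then have "\<exists>a. 0 < a \<and> a < t \<and> ?g t - ?g 0 = (t - 0) * ?g' a"
    using t by (intro MVT2) auto
  then obtain a where a: "0 < a" "a < t"
    "?g t - ?g 0 = t * (ddir u f (x + t *\<^sub>R v + a *\<^sub>R u) - ddir u f (x + a *\<^sub>R u))" by auto
  have "\<exists>b. 0 < b \<and> b < t \<and> ddir u f (x + a *\<^sub>R u + t *\<^sub>R v) - ddir u f (x + a *\<^sub>R u + 0 *\<^sub>R v)
      = (t - 0) * ddir v (ddir u f) (x + a *\<^sub>R u + b *\<^sub>R v)"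
    using box[of a] a t by (intro MVT2) (auto intro!: line smooth_onD(2)[OF f])
  then obtain b where "0 < b" "b < t"
    "ddir u f (x + t *\<^sub>R v + a *\<^sub>R u) - ddir u f (x + a *\<^sub>R u)
      = t * ddir v (ddir u f) (x + a *\<^sub>R u + b *\<^sub>R v)"
    by (auto simp: add_ac)
  then show ?thesis
    using a by (intro exI[of _ a] exI[of _ b]) (auto simp: add_ac)
qed

text \<open>If the mixed derivatives differed at \<open>x\<close>, continuity would keep them apart
  on a small square at \<open>x\<close>, whereas the second difference over the square makes a value
  of one equal to a value of the other.\<close>

lemma ddir_commute:
  fixes f :: "'a::real_normed_vector \<Rightarrow> real"
  assumes f: "smooth_on U f" and U: "open U" "x \<in> U"
  shows "ddir v (ddir u f) x = ddir u (ddir v f) x"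
proof (rule ccontr)
  let ?F = "ddir v (ddir u f)" and ?G = "ddir u (ddir v f)"
  assume "?F x \<noteq> ?G x"
  define e where "e = \<bar>?F x - ?G x\<bar> / 2"
  have "e > 0" using \<open>?F x \<noteq> ?G x\<close> by (simp add: e_def)
  have "continuous (at x) ?F" "continuous (at x) ?G"
    using smooth_onD(3)[OF smooth_onD(2)[OF smooth_onD(2)[OF f]]] U
    by (simp_all add: continuous_on_eq_continuous_at)
  then obtain d1 d2 where d: "d1 > 0" "d2 > 0"
    "\<And>y. dist y x < d1 \<Longrightarrow> \<bar>?F y - ?F x\<bar> < e" "\<And>y. dist y x < d2 \<Longrightarrow> \<bar>?G y - ?G x\<bar> < e"
    using \<open>e > 0\<close> unfolding continuous_at_eps_delta dist_real_def by metis
  obtain d3 where d3: "d3 > 0" "ball x d3 \<subseteq> U"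
    using U by (meson open_contains_ball)
  define d where "d = min d1 (min d2 d3)"
  have "d > 0" using d d3 by (simp add: d_def)
  \<comment> \<open>The summand \<open>1\<close> keeps \<open>K\<close> positive when
    \<open>u\<close> and \<open>v\<close> both vanish; \<open>t\<close> then places the square
    within distance \<open>d / 2\<close> of \<open>x\<close>.\<close>
  define K where "K = norm u + norm v + 1"
  define t where "t = d / (2 * K)"
  have pos: "K > 0"
    unfolding K_def by (smt (verit) norm_ge_zero)
  have t: "t > 0" using d d3 pos by (simp add: t_def d_def)
  have small: "dist (x + a *\<^sub>R u + b *\<^sub>R v) x < d"
    if "0 \<le> a" "a \<le> t" "0 \<le> b" "b \<le> t" for a b
  proof -
    have "dist (x + a *\<^sub>R u + b *\<^sub>R v) x \<le> norm (a *\<^sub>R u) + norm (b *\<^sub>R v)"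
      using norm_triangle_ineq[of "a *\<^sub>R u" "b *\<^sub>R v"] by (simp add: dist_norm add.assoc)
    also have "\<dots> \<le> t * norm u + t * norm v"
      using that by (auto intro!: add_mono mult_right_mono)
    also have "\<dots> \<le> t * K"
      using t by (simp add: K_def algebra_simps)
    also have "\<dots> = d / 2" using pos by (simp add: t_def)
    also have "\<dots> < d" using \<open>d > 0\<close> by simp
    finally show ?thesis .
  qed
  have box: "x + a *\<^sub>R u + b *\<^sub>R v \<in> U" if "0 \<le> a" "a \<le> t" "0 \<le> b" "b \<le> t" for a b
    using small[OF that] d3 by (auto simp: d_def dist_commute subset_eq)
  have box': "x + b *\<^sub>R v + a *\<^sub>R u \<in> U" if "0 \<le> b" "b \<le> t" "0 \<le> a" "a \<le> t" for a b
    using box[OF that(3,4,1,2)] by (simp add: add_ac)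
  obtain a b where ab: "0 \<le> a" "a \<le> t" "0 \<le> b" "b \<le> t"
    "f (x + t *\<^sub>R u + t *\<^sub>R v) - f (x + t *\<^sub>R u) - f (x + t *\<^sub>R v) + f x
      = t * t * ?F (x + a *\<^sub>R u + b *\<^sub>R v)"
    using ddir_swap_mvt[OF f t box] by blast
  obtain a' b' where ab': "0 \<le> a'" "a' \<le> t" "0 \<le> b'" "b' \<le> t"
    "f (x + t *\<^sub>R v + t *\<^sub>R u) - f (x + t *\<^sub>R v) - f (x + t *\<^sub>R u) + f x
      = t * t * ?G (x + b' *\<^sub>R v + a' *\<^sub>R u)"
    using ddir_swap_mvt[OF f t box'] by blast
  have "f (x + t *\<^sub>R v + t *\<^sub>R u) = f (x + t *\<^sub>R u + t *\<^sub>R v)"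
    by (simp add: add_ac)
  then have "t * t * ?F (x + a *\<^sub>R u + b *\<^sub>R v) = t * t * ?G (x + b' *\<^sub>R v + a' *\<^sub>R u)"
    using ab(5) ab'(5) by linarith
  then have "?F (x + a *\<^sub>R u + b *\<^sub>R v) = ?G (x + b' *\<^sub>R v + a' *\<^sub>R u)"
    using t by simp
  moreover have "\<bar>?F (x + a *\<^sub>R u + b *\<^sub>R v) - ?F x\<bar> < e"
    using small[OF ab(1-4)] by (intro d) (simp add: d_def)
  moreover have "\<bar>?G (x + b' *\<^sub>R v + a' *\<^sub>R u) - ?G x\<bar> < e"
    using small[OF ab'(1-4)] by (intro d) (simp add: d_def add_ac)
  moreover have "2 * e = \<bar>?F x - ?G x\<bar>"
    by (simp add: e_def)
  ultimately show False
    by arith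
qed

section \<open>Level sets and hypersurfaces\<close>

lemma open_Collect_smooth_nonzero:
  fixes f :: "'a::real_normed_vector \<Rightarrow> real"
  assumes "open U" "smooth_on U f"
  shows "open {x \<in> U. f x \<noteq> 0}"
proof -
  have "{x \<in> U. f x \<noteq> 0} = U \<inter> f -` (- {0})" by auto
  then show ?thesis
    using continuous_open_preimage[OF smooth_onD(3)[OF assms(2)] assms(1), of "- {0}"] by auto
qed

text \<open>The map \<open>\<Phi> x = x + (\<rho> x - g \<bullet> (x - p)) *\<^sub>R w\<close> has derivative the identity at \<open>p\<close> and sends
  the zero set of \<open>\<rho>\<close> into a hyperplane.\<close>

lemma level_set_straightening:
  fixes \<rho> :: "'a::euclidean_space \<Rightarrow> real"
  assumes U: "open U" "p \<in> U" and \<rho>: "smooth_on U \<rho>" "\<rho> p = 0"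
    and g: "g \<noteq> 0" "\<And>v. ddir v \<rho> p = g \<bullet> v"
  obtains w W V \<Phi> \<Psi> D where "open W" "W \<subseteq> U" "p \<in> W" "open V" "p \<in> V" "\<Phi> p = p"
    "homeomorphism W V \<Phi> \<Psi>" "\<And>y. y \<in> V \<Longrightarrow> (\<Psi> has_derivative D y) (at y)"
    "\<And>X. D p X = X" "\<And>y. y \<in> V \<Longrightarrow> \<rho> (\<Psi> y) = g \<bullet> (y - p)"
    "\<And>x. x \<in> W \<Longrightarrow> ddir w \<rho> x \<noteq> 0"
    "\<And>y X. y \<in> V \<Longrightarrow> g \<bullet> X = 0 \<Longrightarrow> D y X = X - (ddir X \<rho> (\<Psi> y) / ddir w \<rho> (\<Psi> y)) *\<^sub>R w"
proof -
  \<comment> \<open>Normalised so that a step along \<open>w\<close> raises \<open>g\<close> by its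
    length parameter; hence \<open>g \<bullet> (\<Phi> x - p) = \<rho> x\<close>.\<close>
  define w where "w = (1 / (g \<bullet> g)) *\<^sub>R g"
  have gw: "g \<bullet> w = 1" using g by (simp add: w_def)
  define U0 where "U0 = {x \<in> U. ddir w \<rho> x \<noteq> 0}"
  have U0: "open U0" "p \<in> U0" "U0 \<subseteq> U"
    using open_Collect_smooth_nonzero[OF U(1) smooth_onD(2)[OF \<rho>(1)]] U(2) g gw
    by (auto simp: U0_def)
  \<comment> \<open>The inverse function theorem wants the derivative as a continuous map into
    bounded operators. Written over \<open>Basis\<close>, its continuity is that of finitely many
    partial derivatives.\<close>
  define L where "L b = Blinfun (\<lambda>v::'a. (v \<bullet> b) *\<^sub>R w)" for b :: 'a
  have L: "L b v = (v \<bullet> b) *\<^sub>R w" for b v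
    unfolding L_def by (subst bounded_linear_Blinfun_apply) (auto intro!: bounded_linear_intros)
  define f' where "f' x = id_blinfun + (\<Sum>b\<in>Basis. (ddir b \<rho> x - g \<bullet> b) *\<^sub>R L b)" for x
  define \<Phi> where "\<Phi> x = x + (\<rho> x - g \<bullet> (x - p)) *\<^sub>R w" for x
  have f': "f' x v = v + (ddir v \<rho> x - g \<bullet> v) *\<^sub>R w" if "x \<in> U" for x v
  proof -
    have "(\<Sum>b\<in>Basis. (ddir b \<rho> x - g \<bullet> b) * (v \<bullet> b)) = ddir v \<rho> x - g \<bullet> v"
      using linear_frechet_derivative_sum[OF smooth_onD(1)[OF \<rho>(1) that], of v]
      by (simp add: algebra_simps sum_subtractf euclidean_inner[of g v])
    then show ?thesis
      by (simp add: f'_def blinfun.add_left blinfun.sum_left blinfun.scaleR_left L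
          flip: scaleR_sum_left)
  qed
  have f'p: "f' p = id_blinfun"
    using f'[OF U(2)] g(2) by (intro blinfun_eqI) simp
  have der: "(\<Phi> has_derivative blinfun_apply (f' x)) (at x)" if "x \<in> U0" for x
  proof -
    have "x \<in> U" using that U0 by auto
    have "(\<Phi> has_derivative (\<lambda>v. v + (ddir v \<rho> x - g \<bullet> v) *\<^sub>R w)) (at x)"
      unfolding \<Phi>_def using smooth_onD(1)[OF \<rho>(1) \<open>x \<in> U\<close>]
      by (auto intro!: derivative_eq_intros has_derivative_ddir)
    moreover have "blinfun_apply (f' x) = (\<lambda>v. v + (ddir v \<rho> x - g \<bullet> v) *\<^sub>R w)"
      by (intro ext f' \<open>x \<in> U\<close>)
    ultimately show ?thesis by simp
  qed
  have cont: "continuous_on U0 f'"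
    unfolding f'_def
    by (intro continuous_intros continuous_on_subset[OF smooth_onD(3)[OF smooth_onD(2)[OF \<rho>(1)]]] U0)
  have "id_blinfun o\<^sub>L f' p = id_blinfun"
    by (simp add: f'p blinfun_eqI)
  note ift = inverse_function_theorem[OF U0(1) der cont U0(2) this]
  obtain W V \<Psi> D where W: "open W" "W \<subseteq> U0" "p \<in> W" and V: "open V" "\<Phi> p \<in> V"
    and hom: "homeomorphism W V \<Phi> \<Psi>"
    and D: "\<And>y. y \<in> V \<Longrightarrow> (\<Psi> has_derivative D y) (at y)"
      "\<And>y. y \<in> V \<Longrightarrow> D y = inv (blinfun_apply (f' (\<Psi> y)))"
      "\<And>y. y \<in> V \<Longrightarrow> bij (blinfun_apply (f' (\<Psi> y)))"
    by (rule ift, assumption, rule that)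
  have \<Phi>p: "\<Phi> p = p" by (simp add: \<Phi>_def \<rho>)
  have \<Psi>W: "\<Psi> y \<in> W" "\<Phi> (\<Psi> y) = y" if "y \<in> V" for y
    using hom that by (auto simp: homeomorphism_def)
  have \<rho>\<Psi>: "\<rho> (\<Psi> y) = g \<bullet> (y - p)" if "y \<in> V" for y
  proof -
    have "g \<bullet> (\<Phi> x - p) = \<rho> x" for x
      using gw by (simp add: \<Phi>_def inner_add_right inner_diff_right)
    then show ?thesis using \<Psi>W[OF that] by metis
  qed
  have Deq: "D y X + (ddir (D y X) \<rho> (\<Psi> y) - g \<bullet> D y X) *\<^sub>R w = X" if "y \<in> V" for y X
  proof -
    have "f' (\<Psi> y) (D y X) = X"
      using D(2,3)[OF that] by (simp add: bij_is_surj surj_f_inv_f)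
    then show ?thesis
      using f'[of "\<Psi> y" "D y X"] \<Psi>W(1)[OF that] W(2) U0(3) by (metis subsetD)
  qed
  show ?thesis
  proof (rule that[of W V \<Phi> \<Psi> D w])
    have "\<Psi> p = p"
      using hom W(3) \<Phi>p by (metis homeomorphism_apply1)
    then show "D p X = X" for X
      using D(2)[of p] V \<Phi>p by (simp add: f'p \<open>\<Psi> p = p\<close> inv_f_eq inj_def)
    show "ddir w \<rho> x \<noteq> 0" if "x \<in> W" for x
      using that W(2) by (auto simp: U0_def)
    fix y X assume y: "y \<in> V" and X: "g \<bullet> X = 0"
    \<comment> \<open>\<open>\<Phi>\<close> moves points along \<open>w\<close> only, so
      \<open>D y X\<close> differs from \<open>X\<close> by a multiple of \<open>w\<close>. Pairing
      with \<open>g\<close> shows that \<open>D y X\<close> is tangent to the level set of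
      \<open>\<rho>\<close>, which fixes the coefficient.\<close>
    define s where "s = ddir (D y X) \<rho> (\<Psi> y) - g \<bullet> D y X"
    have DX: "D y X = X - s *\<^sub>R w"
      using Deq[OF y, of X] unfolding s_def by (metis add_diff_cancel_right')
    have l: "linear (frechet_derivative \<rho> (at (\<Psi> y)))"
      using \<Psi>W(1)[OF y] W(2) U0(3) by (intro linear_frechet_derivative smooth_onD(1)[OF \<rho>(1)]) auto
    have "ddir (D y X) \<rho> (\<Psi> y) = ddir X \<rho> (\<Psi> y) - s * ddir w \<rho> (\<Psi> y)"
      by (simp add: DX linear_diff[OF l] linear_cmul[OF l])
    moreover have "g \<bullet> D y X = - s"
      using gw X by (simp add: DX inner_diff_right)
    ultimately have "s * ddir w \<rho> (\<Psi> y) = ddir X \<rho> (\<Psi> y)"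
      using s_def by linarith
    moreover have "ddir w \<rho> (\<Psi> y) \<noteq> 0"
      using \<Psi>W(1)[OF y] W(2) by (auto simp: U0_def)
    ultimately have "s = ddir X \<rho> (\<Psi> y) / ddir w \<rho> (\<Psi> y)"
      by (metis nonzero_mult_div_cancel_right)
    then show "D y X = X - (ddir X \<rho> (\<Psi> y) / ddir w \<rho> (\<Psi> y)) *\<^sub>R w"
      using DX by simp
  qed (use W V U0 \<Phi>p hom D(1) \<rho>\<Psi> in auto)
qed

text \<open>The curve is the image under \<open>\<Psi>\<close> of a straight line in the hyperplane.
  The inverse function theorem yields only a first derivative of \<open>\<Psi>\<close>, so
  smoothness is bootstrapped: the velocity is a smooth expression in derivatives of
  \<open>\<rho>\<close> at \<open>\<gamma> t\<close>, and each order of smoothness of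
  \<open>\<gamma>\<close> gives the next.\<close>

lemma level_set_tangent_curve:
  fixes \<rho> :: "'a::euclidean_space \<Rightarrow> real"
  assumes U: "open U" "p \<in> U" and \<rho>: "smooth_on U \<rho>" "\<rho> p = 0"
    and g: "g \<noteq> 0" "\<And>v. ddir v \<rho> p = g \<bullet> v" and X: "g \<bullet> X = 0"
  shows "\<exists>\<epsilon>>0. \<exists>\<gamma>::real \<Rightarrow> 'a. smooth_on {-\<epsilon><..<\<epsilon>} \<gamma> \<and>
    \<gamma> ` {-\<epsilon><..<\<epsilon>} \<subseteq> {x \<in> U. \<rho> x = 0} \<and> \<gamma> 0 = p \<and> (\<gamma> has_vector_derivative X) (at 0)"
proof -
  obtain w W V \<Phi> \<Psi> D where W: "open W" "W \<subseteq> U" "p \<in> W" and V: "open V" "p \<in> V" "\<Phi> p = p"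
    and hom: "homeomorphism W V \<Phi> \<Psi>" and D: "\<And>y. y \<in> V \<Longrightarrow> (\<Psi> has_derivative D y) (at y)"
    and Dp: "\<And>X. D p X = X" and \<rho>\<Psi>: "\<And>y. y \<in> V \<Longrightarrow> \<rho> (\<Psi> y) = g \<bullet> (y - p)"
    and w: "\<And>x. x \<in> W \<Longrightarrow> ddir w \<rho> x \<noteq> 0"
    and DX: "\<And>y X. y \<in> V \<Longrightarrow> g \<bullet> X = 0 \<Longrightarrow>
      D y X = X - (ddir X \<rho> (\<Psi> y) / ddir w \<rho> (\<Psi> y)) *\<^sub>R w"
    by (rule level_set_straightening[OF U \<rho> g]) (rule that)
  have \<Psi>W: "\<Psi> y \<in> W" if "y \<in> V" for y
    using hom that by (auto simp: homeomorphism_def)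
  have "open ((\<lambda>t::real. p + t *\<^sub>R X) -` V)"
    by (intro open_vimage V continuous_intros)
  moreover have "0 \<in> (\<lambda>t::real. p + t *\<^sub>R X) -` V"
    using V by simp
  ultimately obtain \<epsilon> where \<epsilon>: "\<epsilon> > 0" "ball 0 \<epsilon> \<subseteq> (\<lambda>t. p + t *\<^sub>R X) -` V"
    by (rule openE)
  define S where "S = {-\<epsilon><..<\<epsilon>}"
  have S: "open S" "\<And>t. t \<in> S \<Longrightarrow> p + t *\<^sub>R X \<in> V"
    using \<epsilon> by (auto simp: S_def subset_eq dist_real_def)
  define \<gamma> where "\<gamma> t = \<Psi> (p + t *\<^sub>R X)" for t
  have der: "(\<gamma> has_vector_derivative D (p + t *\<^sub>R X) X) (at t)" if "t \<in> S" for t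
  proof -
    have "((\<lambda>s. p + s *\<^sub>R X) has_vector_derivative X) (at t)"
      by (auto intro!: derivative_eq_intros simp: has_vector_derivative_def)
    from vector_derivative_diff_chain_within[OF this has_derivative_at_withinI[OF D[OF S(2)[OF that]]]]
    show ?thesis by (simp add: o_def \<gamma>_def[abs_def])
  qed
  have \<gamma>W: "\<gamma> ` S \<subseteq> W" using S \<Psi>W by (auto simp: \<gamma>_def)
  have "k_smooth_on k S \<gamma>" for k
  proof (induction k)
    case 0
    have "\<gamma> differentiable at t" if "t \<in> S" for t
      using der[OF that] by (auto simp: differentiable_def has_vector_derivative_def)
    then show ?case
      by (auto intro!: continuous_at_imp_continuous_on differentiable_imp_continuous_within)
  next
    case (Suc k)
    have d: "(\<gamma> has_derivative (\<lambda>v. v *\<^sub>R D (p + t *\<^sub>R X) X)) (at t)" if "t \<in> S" for t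
      using der[OF that] by (simp add: has_vector_derivative_def)
    have sm: "smooth_on W (ddir Y \<rho>)" for Y
      using smooth_on_subset[OF smooth_onD(2)[OF \<rho>(1)] W(2)] .
    have c: "k_smooth_on k S (\<lambda>t. ddir Y \<rho> (\<gamma> t))" for Y
      by (rule k_smooth_on_compose[OF sm Suc.IH \<gamma>W S(1) W(1)])
    have "k_smooth_on k S (ddir v \<gamma>)" for v
    proof (rule k_smooth_on_cong[OF S(1)])
      have "k_smooth_on k S (\<lambda>t. (ddir X \<rho> (\<gamma> t) * inverse (ddir w \<rho> (\<gamma> t))) *\<^sub>R (- w))"
        using \<gamma>W w
        by (intro k_smooth_on_bilinear[OF bounded_bilinear_scaleR]
            k_smooth_on_bilinear[OF bounded_bilinear_mult] k_smooth_on_inverse c S) auto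
      then show "k_smooth_on k S
          (\<lambda>t. v *\<^sub>R (X + (ddir X \<rho> (\<gamma> t) * inverse (ddir w \<rho> (\<gamma> t))) *\<^sub>R (- w)))"
        by (intro k_smooth_on_bounded_linear[OF bounded_linear_scaleR_right] k_smooth_on_add S) auto
    qed (use DX[OF S(2) X] in \<open>simp add: ddir_eq[OF d] \<gamma>_def divide_inverse\<close>)
    with d show ?case by (auto simp: differentiable_def)
  qed
  moreover have "\<rho> (\<gamma> t) = 0" if "t \<in> S" for t
    using \<rho>\<Psi>[OF S(2)[OF that]] X by (simp add: \<gamma>_def)
  moreover have "\<gamma> 0 = p"
    using hom W(3) V(3) by (simp add: \<gamma>_def) (metis homeomorphism_apply1)
  moreover have "(\<gamma> has_vector_derivative X) (at 0)"
    using der[of 0] \<epsilon>(1) Dp by (simp add: S_def)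
  ultimately show ?thesis
    using \<epsilon>(1) \<gamma>W W(2) unfolding S_def smooth_on_def by (intro exI[of _ \<epsilon>] exI[of _ \<gamma>] conjI) auto
qed

text \<open>For \<open>q\<close> in the zero set the segment from \<open>p\<close> to
  \<open>\<Phi> q\<close> lies in the hyperplane, and \<open>\<Psi>\<close> carries it back into the
  zero set. The open set \<open>S\<close> makes the derivatives at both ends two-sided.\<close>

lemma level_set_locally_curve_connected:
  fixes \<rho> :: "'a::euclidean_space \<Rightarrow> real"
  assumes U: "open U" "p \<in> U" and \<rho>: "smooth_on U \<rho>" "\<rho> p = 0"
    and g: "g \<noteq> 0" "\<And>v. ddir v \<rho> p = g \<bullet> v"
  shows "\<exists>W. open W \<and> p \<in> W \<and> W \<subseteq> U \<and> (\<forall>q\<in>W. \<rho> q = 0 \<longrightarrow> (\<exists>\<gamma> S. open S \<and> {0..1} \<subseteq> S \<and>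
    \<gamma> 0 = p \<and> \<gamma> 1 = q \<and> (\<forall>t\<in>S. \<gamma> t \<in> U \<and> \<rho> (\<gamma> t) = 0 \<and> \<gamma> differentiable (at (t::real)))))"
proof -
  obtain w W V \<Phi> \<Psi> D where W: "open W" "W \<subseteq> U" "p \<in> W" and V: "open V" "p \<in> V" "\<Phi> p = p"
    and hom: "homeomorphism W V \<Phi> \<Psi>" and D: "\<And>y. y \<in> V \<Longrightarrow> (\<Psi> has_derivative D y) (at y)"
    and Dp: "\<And>X. D p X = X" and \<rho>\<Psi>: "\<And>y. y \<in> V \<Longrightarrow> \<rho> (\<Psi> y) = g \<bullet> (y - p)"
    and w: "\<And>x. x \<in> W \<Longrightarrow> ddir w \<rho> x \<noteq> 0"
    and DX: "\<And>y X. y \<in> V \<Longrightarrow> g \<bullet> X = 0 \<Longrightarrow>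
      D y X = X - (ddir X \<rho> (\<Psi> y) / ddir w \<rho> (\<Psi> y)) *\<^sub>R w"
    by (rule level_set_straightening[OF U \<rho> g]) (rule that)
  obtain d where d: "d > 0" "ball p d \<subseteq> V"
    using V by (meson open_contains_ball)
  define W' where "W' = W \<inter> \<Phi> -` ball p d"
  have "open W'" unfolding W'_def
    using hom W(1) by (intro continuous_open_preimage) (auto simp: homeomorphism_def)
  moreover have "p \<in> W'" using W d V by (simp add: W'_def)
  moreover have "\<exists>\<gamma> S. open S \<and> {0..1} \<subseteq> S \<and> \<gamma> 0 = p \<and> \<gamma> 1 = q \<and>
      (\<forall>t\<in>S. \<gamma> t \<in> U \<and> \<rho> (\<gamma> t) = 0 \<and> \<gamma> differentiable (at (t::real)))"
    if q: "q \<in> W'" "\<rho> q = 0" for q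
  proof -
    define l where "l t = p + t *\<^sub>R (\<Phi> q - p)" for t :: real
    have qW: "q \<in> W" "\<Phi> q \<in> ball p d" using q by (auto simp: W'_def)
    have \<Psi>q: "\<Psi> (\<Phi> q) = q" "\<Psi> p = p"
      using hom qW(1) W(3) V(3) by (metis homeomorphism_apply1)+
    have gq: "g \<bullet> (\<Phi> q - p) = 0"
      using \<rho>\<Psi>[of "\<Phi> q"] qW d \<Psi>q q by auto
    define S where "S = l -` ball p d"
    have "open S" unfolding S_def l_def
      by (intro open_vimage continuous_intros) auto
    moreover have "{0..1} \<subseteq> S"
    proof
      fix t :: real assume t: "t \<in> {0..1}"
      have "dist p (l t) = t * dist p (\<Phi> q)"
        using t by (simp add: l_def dist_norm norm_minus_commute)
      also have "\<dots> \<le> dist p (\<Phi> q)" using t by (simp add: mult_left_le_one_le)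
      also have "\<dots> < d" using qW by simp
      finally show "t \<in> S" by (simp add: S_def)
    qed
    moreover have "\<Psi> (l t) \<in> U \<and> \<rho> (\<Psi> (l t)) = 0 \<and> (\<lambda>t. \<Psi> (l t)) differentiable (at t)"
      if "t \<in> S" for t
    proof -
      have lt: "l t \<in> V" using that d by (auto simp: S_def)
      have "\<Psi> (l t) \<in> U" using hom lt W(2) by (auto simp: homeomorphism_def)
      moreover have "\<rho> (\<Psi> (l t)) = 0"
        using \<rho>\<Psi>[OF lt] gq by (simp add: l_def)
      moreover have "(\<Psi> \<circ> l) differentiable (at t)"
        by (rule differentiable_chain_at) (use D[OF lt] in \<open>auto simp: differentiable_def l_def[abs_def]
          intro!: derivative_eq_intros exI\<close>)
      ultimately show ?thesis by (simp add: o_def)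
    qed
    ultimately show ?thesis
      using \<Psi>q by (intro exI[of _ "\<lambda>t. \<Psi> (l t)"] exI[of _ S]) (simp add: l_def)
  qed
  ultimately show ?thesis
    using W(2) by (intro exI[of _ W']) (auto simp: W'_def)
qed

text \<open>Meant for functions such as \<open>\<nu>\<close> whose values off \<open>M\<close> carry
  no information. Testing on every curve in \<open>M\<close> with velocity \<open>v\<close> makes
  the rules of calculus immediate; the value is unique once one such curve exists.\<close>

definition deriv_along ::
  "'a::real_normed_vector set \<Rightarrow> 'a \<Rightarrow> 'a \<Rightarrow> ('a \<Rightarrow> 'b::real_normed_vector) \<Rightarrow> 'b \<Rightarrow> bool" where
  "deriv_along M p v f D \<longleftrightarrow> (\<forall>\<gamma>::real \<Rightarrow> 'a. \<gamma> 0 = p \<longrightarrow> (\<forall>\<^sub>F t in nhds 0. \<gamma> t \<in> M) \<longrightarrow>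
     (\<gamma> has_vector_derivative v) (at 0) \<longrightarrow> ((\<lambda>t. f (\<gamma> t)) has_vector_derivative D) (at 0))"

lemma deriv_along_const: "deriv_along M p v (\<lambda>_. a) 0"
  by (simp add: deriv_along_def)

lemma deriv_along_ident: "deriv_along M p v (\<lambda>x. x) v"
  by (simp add: deriv_along_def)

lemma deriv_along_linear:
  "bounded_linear L \<Longrightarrow> deriv_along M p v f D \<Longrightarrow> deriv_along M p v (\<lambda>x. L (f x)) (L D)"
  unfolding deriv_along_def using bounded_linear.has_vector_derivative by blast

lemma deriv_along_add:
  "deriv_along M p v f D \<Longrightarrow> deriv_along M p v g E \<Longrightarrow> deriv_along M p v (\<lambda>x. f x + g x) (D + E)"
  by (simp add: deriv_along_def has_vector_derivative_add)

lemma deriv_along_diff: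
  "deriv_along M p v f D \<Longrightarrow> deriv_along M p v g E \<Longrightarrow> deriv_along M p v (\<lambda>x. f x - g x) (D - E)"
  by (simp add: deriv_along_def has_vector_derivative_diff)

lemma deriv_along_bilinear:
  fixes M :: "'a::real_normed_vector set"
  assumes "bounded_bilinear B" "deriv_along M p v f D" "deriv_along M p v g E"
  shows "deriv_along M p v (\<lambda>x. B (f x) (g x)) (B (f p) E + B D (g p))"
  unfolding deriv_along_def
proof (intro allI impI)
  fix \<gamma> :: "real \<Rightarrow> 'a"
  assume \<gamma>: "\<gamma> 0 = p" "\<forall>\<^sub>F t in nhds 0. \<gamma> t \<in> M" "(\<gamma> has_vector_derivative v) (at 0)"
  then have "((\<lambda>t. f (\<gamma> t)) has_vector_derivative D) (at 0)"
    "((\<lambda>t. g (\<gamma> t)) has_vector_derivative E) (at 0)"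
    using assms(2,3) by (auto simp: deriv_along_def)
  from bounded_bilinear.has_vector_derivative[OF assms(1) this]
  show "((\<lambda>t. B (f (\<gamma> t)) (g (\<gamma> t))) has_vector_derivative B (f p) E + B D (g p)) (at 0)"
    by (simp add: \<gamma>(1))
qed

lemma deriv_along_sum:
  "(\<And>i. i \<in> I \<Longrightarrow> deriv_along M p v (f i) (D i)) \<Longrightarrow>
    deriv_along M p v (\<lambda>x. \<Sum>i\<in>I. f i x) (\<Sum>i\<in>I. D i)"
  by (induction I rule: infinite_finite_induct) (auto intro: deriv_along_add deriv_along_const)

lemma has_derivative_imp_deriv_along:
  fixes f :: "'a::real_normed_vector \<Rightarrow> 'b::real_normed_vector"
  assumes "(f has_derivative F) (at p)"
  shows "deriv_along M p v f (F v)"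
  unfolding deriv_along_def
proof (intro allI impI)
  fix \<gamma> :: "real \<Rightarrow> 'a"
  assume "\<gamma> 0 = p" and \<gamma>: "(\<gamma> has_vector_derivative v) (at 0)"
  then have "(f has_derivative F) (at (\<gamma> 0) within range \<gamma>)"
    using assms by (simp add: has_derivative_at_withinI)
  from vector_derivative_diff_chain_within[OF \<gamma> this]
  show "((\<lambda>t. f (\<gamma> t)) has_vector_derivative F v) (at 0)"
    by (simp add: o_def)
qed

lemma deriv_along_cong:
  fixes M :: "'a::real_normed_vector set"
  assumes U: "open U" "p \<in> U" and eq: "\<And>x. x \<in> M \<inter> U \<Longrightarrow> f x = g x"
    and f: "deriv_along M p v f D"
  shows "deriv_along M p v g D"
  unfolding deriv_along_def
proof (intro allI impI)
  fix \<gamma> :: "real \<Rightarrow> 'a"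
  assume \<gamma>: "\<gamma> 0 = p" "\<forall>\<^sub>F t in nhds 0. \<gamma> t \<in> M" "(\<gamma> has_vector_derivative v) (at 0)"
  have "isCont \<gamma> 0"
    using \<gamma>(3) by (rule has_vector_derivative_continuous)
  then have "\<forall>\<^sub>F t in nhds 0. \<gamma> t \<in> U"
    using U \<gamma>(1) by (simp add: continuous_at_open eventually_nhds)
  with \<gamma>(2) have ev: "\<forall>\<^sub>F t in nhds 0. f (\<gamma> t) = g (\<gamma> t)"
    by eventually_elim (use eq in auto)
  have "((\<lambda>t. f (\<gamma> t)) has_vector_derivative D) (at 0)"
    using f \<gamma> by (simp add: deriv_along_def)
  then show "((\<lambda>t. g (\<gamma> t)) has_vector_derivative D) (at 0)"
    unfolding has_vector_derivative_def
    by (rule has_derivative_transform_eventually)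
      (use ev in \<open>auto dest: eventually_nhds_x_imp_x simp: eventually_at_filter elim: eventually_mono\<close>)
qed

lemma deriv_along_unique:
  assumes "\<gamma> 0 = p" "\<forall>\<^sub>F t in nhds (0::real). \<gamma> t \<in> M" "(\<gamma> has_vector_derivative v) (at 0)"
    and "deriv_along M p v f D" "deriv_along M p v f E"
  shows "D = E"
  using assms unfolding deriv_along_def by (metis vector_derivative_unique_at)

text \<open>Derivatives of the forms are known on fixed vectors only; expanding the moving argument
  over \<open>Basis\<close> reduces the claim to the product rule.\<close>

lemma deriv_along_linear_arg:
  fixes f :: "'a::euclidean_space \<Rightarrow> 'a \<Rightarrow> real"
  assumes U: "open U" "p \<in> U" and lin: "\<And>x. x \<in> U \<Longrightarrow> linear (f x)" and lin': "linear f'"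
    and f: "\<And>w. deriv_along M p v (\<lambda>x. f x w) (f' w)"
    and X: "deriv_along M p v X X'"
  shows "deriv_along M p v (\<lambda>x. f x (X x)) (f' (X p) + f p X')"
proof -
  have expand: "g w = (\<Sum>b\<in>Basis. (w \<bullet> b) * g b)" if "linear g" for g :: "'a \<Rightarrow> real" and w
  proof -
    have "g w = g (\<Sum>b\<in>Basis. (w \<bullet> b) *\<^sub>R b)" by (simp add: euclidean_representation)
    then show ?thesis by (simp add: linear_sum[OF that] linear_cmul[OF that])
  qed
  have "deriv_along M p v (\<lambda>x. \<Sum>b\<in>Basis. (X x \<bullet> b) * f x b)
      (\<Sum>b\<in>Basis. (X p \<bullet> b) * f' b + (X' \<bullet> b) * f p b)"
    by (intro deriv_along_sum deriv_along_bilinear[OF bounded_bilinear_mult] f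
        deriv_along_linear[OF bounded_linear_inner_left] X)
  moreover have "(\<Sum>b\<in>Basis. (X p \<bullet> b) * f' b + (X' \<bullet> b) * f p b) = f' (X p) + f p X'"
    using expand[OF lin', of "X p"] expand[OF lin[OF U(2)], of X'] by (simp add: sum.distrib)
  ultimately have "deriv_along M p v (\<lambda>x. \<Sum>b\<in>Basis. (X x \<bullet> b) * f x b) (f' (X p) + f p X')"
    by simp
  moreover have "(\<Sum>b\<in>Basis. (X x \<bullet> b) * f x b) = f x (X x)" if "x \<in> M \<inter> U" for x
    using expand[OF lin, of x "X x"] that by simp
  ultimately show ?thesis
    by (rule deriv_along_cong[OF U, rotated])
qed

lemma tangent_space_curve:
  assumes "v \<in> tangent_space M p"
  obtains \<gamma> where "\<gamma> 0 = p" "\<forall>\<^sub>F t in nhds (0::real). \<gamma> t \<in> M" "(\<gamma> has_vector_derivative v) (at 0)"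
proof -
  obtain \<epsilon> \<gamma> where e: "\<epsilon> > 0" "\<gamma> ` {-\<epsilon><..<\<epsilon>} \<subseteq> M" "\<gamma> 0 = p" "(\<gamma> has_vector_derivative v) (at 0)"
    using assms by (auto simp: tangent_space_def)
  have "\<forall>\<^sub>F t in nhds (0::real). t \<in> {-\<epsilon><..<\<epsilon>}"
    using e(1) by (intro eventually_nhds_in_open) auto
  then have "\<forall>\<^sub>F t in nhds (0::real). \<gamma> t \<in> M"
    by eventually_elim (use e(2) in auto)
  with e show ?thesis using that by blast
qed

text \<open>Vectors orthogonal to the gradient \<open>g\<close> of \<open>\<rho>\<close> are
  velocities of curves in \<open>M\<close>, hence orthogonal to \<open>\<nu> p\<close>. This makes
  \<open>\<nu> p\<close> parallel to \<open>g\<close>, and the two orthogonal complements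
  agree.\<close>

lemma hypersurface_tangent_space:
  fixes M :: "'a::euclidean_space set"
  assumes M: "embedded_hypersurface M" and \<nu>: "smooth_unit_normal M \<nu>" and p: "p \<in> M"
  obtains U \<rho> a where "open U" "p \<in> U" "smooth_on U \<rho>" "M \<inter> U = {x \<in> U. \<rho> x = 0}" "a \<noteq> 0"
    "\<And>v. ddir v \<rho> p = (a *\<^sub>R \<nu> p) \<bullet> v" "tangent_space M p = {v. \<nu> p \<bullet> v = 0}"
proof -
  obtain U and \<rho> :: "'a \<Rightarrow> real" where U: "open U" "p \<in> U" "smooth_on U \<rho>" "M \<inter> U = {x \<in> U. \<rho> x = 0}"
    and nz: "frechet_derivative \<rho> (at p) \<noteq> (\<lambda>_. 0)"
    using M p unfolding embedded_hypersurface_def by blast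
  define g where "g = (\<Sum>b\<in>Basis. ddir b \<rho> p *\<^sub>R b)"
  have \<rho>p: "\<rho> p = 0" using U p by auto
  have dg: "ddir v \<rho> p = g \<bullet> v" for v
    using linear_frechet_derivative_sum[OF smooth_onD(1)[OF U(3,2)], of v]
    by (simp add: g_def inner_sum_left inner_commute[of v] mult.commute)
  have g0: "g \<noteq> 0" using nz dg by auto
  have sub: "v \<in> tangent_space M p" if "g \<bullet> v = 0" for v
    using level_set_tangent_curve[OF U(1-3) \<rho>p g0 dg that] U(4)
    unfolding tangent_space_def by blast
  have unit: "\<nu> p \<bullet> \<nu> p = 1" and perp: "\<And>v. v \<in> tangent_space M p \<Longrightarrow> \<nu> p \<bullet> v = 0"
    using \<nu> p by (auto simp: smooth_unit_normal_def dot_square_norm)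
  define a where "a = g \<bullet> \<nu> p"
  \<comment> \<open>The component of \<open>\<nu> p\<close> orthogonal to \<open>g\<close> is
    tangent, so \<open>\<nu> p\<close> is orthogonal to it. This is the equality case of
    Cauchy-Schwarz.\<close>
  have "g \<bullet> (\<nu> p - (a / (g \<bullet> g)) *\<^sub>R g) = 0"
    using g0 by (simp add: inner_diff_right a_def)
  then have "\<nu> p \<bullet> (\<nu> p - (a / (g \<bullet> g)) *\<^sub>R g) = 0"
    using sub perp by blast
  then have "a * a = g \<bullet> g"
    using unit g0 by (simp add: inner_diff_right a_def inner_commute field_simps)
  then have "(g - a *\<^sub>R \<nu> p) \<bullet> (g - a *\<^sub>R \<nu> p) = 0"
    using unit by (simp add: inner_diff_left inner_diff_right a_def inner_commute)
  then have ga: "g = a *\<^sub>R \<nu> p" by simp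
  then have "a \<noteq> 0" using g0 by auto
  then have "tangent_space M p = {v. \<nu> p \<bullet> v = 0}"
    using sub perp ga by (auto simp: inner_scaleR_left)
  then show ?thesis
    using that[of U \<rho> a] U \<open>a \<noteq> 0\<close> dg ga by metis
qed

lemma tangent_space_eq:
  fixes M :: "'a::euclidean_space set"
  assumes "embedded_hypersurface M" "smooth_unit_normal M \<nu>" "p \<in> M"
  shows "tangent_space M p = {v. \<nu> p \<bullet> v = 0}"
  by (rule hypersurface_tangent_space[OF assms])

text \<open>Dividing a defining function by its normal derivative gives one whose gradient along \<open>M\<close> is
  the unit normal.\<close>

lemma hypersurface_normal_chart:
  fixes M :: "'a::euclidean_space set"
  assumes M: "embedded_hypersurface M" and \<nu>: "smooth_unit_normal M \<nu>" and p: "p \<in> M"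
  obtains U r where "open U" "p \<in> U" "smooth_on U r" "\<And>x v. x \<in> M \<inter> U \<Longrightarrow> ddir v r x = \<nu> x \<bullet> v"
proof -
  obtain U and \<rho> :: "'a \<Rightarrow> real" where U: "open U" "p \<in> U" "smooth_on U \<rho>" "M \<inter> U = {x \<in> U. \<rho> x = 0}"
    and nz: "\<And>x. x \<in> M \<inter> U \<Longrightarrow> frechet_derivative \<rho> (at x) \<noteq> (\<lambda>_. 0)"
    using M[unfolded embedded_hypersurface_def, rule_format, OF p]
    by (elim exE conjE) (rule that, assumption+, blast)
  obtain U1 F where F: "open U1" "p \<in> U1" "smooth_on U1 F" "\<And>x. x \<in> U1 \<inter> M \<Longrightarrow> F x = \<nu> x"
    using \<nu> p unfolding smooth_unit_normal_def smooth_along_def by blast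
  have normal: "\<exists>a. a \<noteq> 0 \<and> (\<forall>v. ddir v \<rho> x = a * (\<nu> x \<bullet> v))" if x: "x \<in> M \<inter> U" for x
  proof -
    have "tangent_space M x = {v. \<nu> x \<bullet> v = 0}"
      using tangent_space_eq[OF M \<nu>] x by auto
    then have curve: "v \<in> tangent_space M x" if "\<nu> x \<bullet> v = 0" for v
      using that by simp
    have d0: "deriv_along M x v \<rho> 0" for v
      using U x by (intro deriv_along_cong[OF U(1) _ _ deriv_along_const]) auto
    have d1: "deriv_along M x v \<rho> (ddir v \<rho> x)" for v
      using has_derivative_imp_deriv_along[OF has_derivative_ddir[OF smooth_onD(1)[OF U(3)]]] x by auto
    have z: "ddir v \<rho> x = 0" if "\<nu> x \<bullet> v = 0" for v
      by (rule tangent_space_curve[OF curve[OF that]]) (rule deriv_along_unique[OF _ _ _ d1 d0])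
    have lin: "linear (frechet_derivative \<rho> (at x))"
      using smooth_onD(1)[OF U(3)] x by (auto intro: linear_frechet_derivative)
    have u: "\<nu> x \<bullet> \<nu> x = 1"
      using \<nu> x by (auto simp: smooth_unit_normal_def dot_square_norm)
    have eq: "ddir v \<rho> x = ddir (\<nu> x) \<rho> x * (\<nu> x \<bullet> v)" for v
      using z[of "v - (\<nu> x \<bullet> v) *\<^sub>R \<nu> x"] u
      by (simp add: linear_diff[OF lin] linear_cmul[OF lin] inner_diff_right)
    have "ddir (\<nu> x) \<rho> x \<noteq> 0"
    proof
      assume "ddir (\<nu> x) \<rho> x = 0"
      then have "frechet_derivative \<rho> (at x) v = 0" for v
        by (subst eq) simp
      with nz[OF x] show False by blast
    qed
    with eq show ?thesis by blast
  qed
  \<comment> \<open>The normal derivative of \<open>\<rho>\<close>, formed with the ambient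
    extension \<open>F\<close> of \<open>\<nu>\<close> so that it is smooth on an open set.\<close>
  define \<phi> where "\<phi> x = (\<Sum>b\<in>Basis. (F x \<bullet> b) *\<^sub>R ddir b \<rho> x)" for x
  have sF: "smooth_on (U \<inter> U1) F" "smooth_on (U \<inter> U1) \<rho>"
    using smooth_on_subset[OF F(3)] smooth_on_subset[OF U(3)] by auto
  have s\<phi>: "smooth_on (U \<inter> U1) \<phi>"
    unfolding smooth_on_def \<phi>_def using sF smooth_onD(2)[OF sF(2)] U F
    by (intro allI k_smooth_on_sum k_smooth_on_bilinear[OF bounded_bilinear_scaleR]
        k_smooth_on_bounded_linear[OF bounded_linear_inner_left]) (auto simp: smooth_on_def)
  define W where "W = {x \<in> U \<inter> U1. \<phi> x \<noteq> 0}"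
  have W: "open W" "W \<subseteq> U" "W \<subseteq> U1"
    using open_Collect_smooth_nonzero[OF _ s\<phi>] U F by (auto simp: W_def)
  have \<phi>: "\<phi> x \<noteq> 0 \<and> ddir v \<rho> x = \<phi> x * (\<nu> x \<bullet> v)" if x: "x \<in> M \<inter> U \<inter> U1" for x v
  proof -
    have "x \<in> M \<inter> U" using x by auto
    then obtain a where a: "a \<noteq> 0" "\<And>v. ddir v \<rho> x = a * (\<nu> x \<bullet> v)"
      using normal by metis
    have "\<phi> x = ddir (\<nu> x) \<rho> x"
      using linear_frechet_derivative_sum[OF smooth_onD(1)[OF U(3)], of x "\<nu> x"] F(4)[of x] x
      by (simp add: \<phi>_def)
    also have "\<dots> = a"
      using a \<nu> x by (auto simp: smooth_unit_normal_def dot_square_norm)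
    finally show ?thesis using a by simp
  qed
  define r where "r x = \<rho> x * inverse (\<phi> x)" for x
  have sW: "smooth_on W \<rho>" "smooth_on W \<phi>"
    using smooth_on_subset[OF U(3)] smooth_on_subset[OF s\<phi>] W by auto
  have "smooth_on W r"
    unfolding smooth_on_def r_def using sW W
    by (intro allI k_smooth_on_bilinear[OF bounded_bilinear_mult] k_smooth_on_inverse)
      (auto simp: smooth_on_def W_def)
  moreover have "p \<in> W"
    using \<phi>[of p] p U F by (auto simp: W_def)
  moreover have "ddir v r x = \<nu> x \<bullet> v" if x: "x \<in> M \<inter> W" for x v
  proof -
    have "(r has_derivative (\<lambda>v. \<rho> x * (- (inverse (\<phi> x) * ddir v \<phi> x * inverse (\<phi> x)))
        + ddir v \<rho> x * inverse (\<phi> x))) (at x)"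
      unfolding r_def using x smooth_onD(1)[OF sW(1)] smooth_onD(1)[OF sW(2)]
      by (intro has_derivative_mult Deriv.has_derivative_inverse has_derivative_ddir) (auto simp: W_def)
    moreover have "\<rho> x = 0" "\<phi> x \<noteq> 0" "ddir v \<rho> x = \<phi> x * (\<nu> x \<bullet> v)"
      using \<phi>[of x v] x U(4) W by auto
    ultimately show ?thesis
      by (simp add: ddir_eq)
  qed
  ultimately show ?thesis using that W(1) by blast
qed

text \<open>Nearby points of \<open>M\<close> are joined to \<open>p\<close> by differentiable
  curves in \<open>M\<close>, along which \<open>f\<close> has zero derivative; so \<open>f\<close>
  is locally constant on a connected set.\<close>

lemma deriv_along_zero_imp_constant:
  fixes M :: "'a::euclidean_space set" and f :: "'a \<Rightarrow> 'b::real_normed_vector"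
  assumes M: "embedded_hypersurface M" "connected M" and \<nu>: "smooth_unit_normal M \<nu>"
    and f: "\<And>p v. p \<in> M \<Longrightarrow> \<nu> p \<bullet> v = 0 \<Longrightarrow> deriv_along M p v f 0"
  shows "f constant_on M"
proof (rule locally_constant_imp_constant[OF M(2)])
  have shift: "((\<lambda>s. a + s) has_vector_derivative 1) (at x)" for a x :: real
    by (auto simp: has_vector_derivative_def intro!: derivative_eq_intros)
  fix p assume p: "p \<in> M"
  obtain U \<rho> a where U: "open U" "p \<in> U" "smooth_on U \<rho>" "M \<inter> U = {x \<in> U. \<rho> x = 0}" "a \<noteq> 0"
    "\<And>v. ddir v \<rho> p = (a *\<^sub>R \<nu> p) \<bullet> v" "tangent_space M p = {v. \<nu> p \<bullet> v = 0}"
    by (rule hypersurface_tangent_space[OF M(1) \<nu> p]) (rule that)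
  have a\<nu>: "a *\<^sub>R \<nu> p \<noteq> 0"
    using \<nu> p U(5) by (auto simp: smooth_unit_normal_def)
  have \<rho>p: "\<rho> p = 0" using U p by auto
  obtain W where W: "open W" "p \<in> W" "W \<subseteq> U" and curve: "\<And>q. q \<in> W \<Longrightarrow> \<rho> q = 0 \<Longrightarrow>
      \<exists>\<gamma> S. open S \<and> {0..1} \<subseteq> S \<and> \<gamma> 0 = p \<and> \<gamma> 1 = q \<and>
      (\<forall>t\<in>S. \<gamma> t \<in> U \<and> \<rho> (\<gamma> t) = 0 \<and> \<gamma> differentiable (at (t::real)))"
    using level_set_locally_curve_connected[OF U(1-3) \<rho>p a\<nu> U(6)] by blast
  have "f q = f p" if q: "q \<in> M \<inter> W" for q
  proof -
    have "\<rho> q = 0" using q W U by auto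
    then obtain \<gamma> S where S: "open S" "{0..1} \<subseteq> S" "\<gamma> 0 = p" "\<gamma> 1 = q"
      "\<And>t. t \<in> S \<Longrightarrow> \<gamma> t \<in> M" "\<And>t. t \<in> S \<Longrightarrow> \<gamma> differentiable (at (t::real))"
      using curve[of q] q U(4) by blast
    have "((\<lambda>t. f (\<gamma> t)) has_derivative (\<lambda>_. 0)) (at t)" if t: "t \<in> S" for t
    proof -
      define l where "l s = \<gamma> (t + s)" for s
      obtain v where v: "(\<gamma> has_vector_derivative v) (at t)"
        using S(6)[OF t] vector_derivative_works by blast
      have l: "(l has_vector_derivative v) (at 0)"
        using vector_diff_chain_at[OF shift[of t 0], of \<gamma> v] v by (simp add: l_def[abs_def] o_def)
      have "open ((\<lambda>s. t + s) -` S)"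
        by (intro open_vimage S continuous_intros)
      then have "\<forall>\<^sub>F s in nhds 0. s \<in> (\<lambda>s. t + s) -` S"
        using t by (intro eventually_nhds_in_open) auto
      then have ev: "\<forall>\<^sub>F s in nhds 0. l s \<in> M"
        by eventually_elim (use S(5) in \<open>auto simp: l_def\<close>)
      have \<gamma>t: "\<gamma> t \<in> M" using S(5) t by blast
      \<comment> \<open>The curve is merely differentiable, so its velocity is not tangent by
        definition. It is orthogonal to \<open>\<nu>\<close> because a defining function near
        \<open>\<gamma> t\<close> vanishes along the curve.\<close>
      obtain U' r b where U': "open U'" "\<gamma> t \<in> U'" "smooth_on U' r"
        "M \<inter> U' = {x \<in> U'. r x = 0}"
        and b: "b \<noteq> 0" "\<And>v. ddir v r (\<gamma> t) = (b *\<^sub>R \<nu> (\<gamma> t)) \<bullet> v"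
          "tangent_space M (\<gamma> t) = {v. \<nu> (\<gamma> t) \<bullet> v = 0}"
        by (rule hypersurface_tangent_space[OF M(1) \<nu> \<gamma>t]) (rule that)
      have "deriv_along M (\<gamma> t) v r 0"
        using U' by (intro deriv_along_cong[OF U'(1) _ _ deriv_along_const]) auto
      moreover have "deriv_along M (\<gamma> t) v r (ddir v r (\<gamma> t))"
        using has_derivative_imp_deriv_along[OF has_derivative_ddir[OF smooth_onD(1)[OF U'(3,2)]]] .
      ultimately have "ddir v r (\<gamma> t) = 0"
        using deriv_along_unique[of l "\<gamma> t" M v] ev l by (auto simp: l_def)
      with b have "\<nu> (\<gamma> t) \<bullet> v = 0" by auto
      from f[OF \<gamma>t this] have "((\<lambda>s. f (l s)) has_vector_derivative 0) (at 0)"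
        unfolding deriv_along_def by (rule allE[of _ l]) (use ev l in \<open>simp add: l_def[of 0]\<close>)
      then have "((\<lambda>s. f (l s)) has_vector_derivative 0) (at (- t + t))" by simp
      from vector_diff_chain_at[OF shift this] show ?thesis
        by (simp add: l_def[abs_def] o_def has_vector_derivative_def)
    qed
    then have "((\<lambda>t. f (\<gamma> t)) has_derivative (\<lambda>_. 0)) (at t within {0..1})" if "t \<in> {0..1}" for t
      using that S(2) has_derivative_at_withinI by blast
    then have "f (\<gamma> 1) = f (\<gamma> 0)"
      using has_derivative_zero_unique[of "{0..1::real}" "\<lambda>t. f (\<gamma> t)"] by fastforce
    then show ?thesis using S by simp
  qed
  then show "\<exists>T. openin (top_of_set M) T \<and> p \<in> T \<and> (\<forall>x\<in>T. f x = f p)"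
    using W(1,2) p openin_open_Int[OF W(1), of M] by blast
qed

section \<open>Levi umbilical hypersurfaces in a chart\<close>

lemma orthogonal_to_list_exists:
  fixes xs :: "'a::euclidean_space list"
  assumes "length xs < DIM('a)"
  obtains e where "e \<noteq> 0" "\<And>y. y \<in> set xs \<Longrightarrow> y \<bullet> e = 0"
proof -
  have "dim (set xs) < DIM('a)"
    using assms card_length[of xs] dim_le_card'[of "set xs"] by simp
  then show ?thesis
    using orthogonal_to_subspace_exists[of "set xs"] that
    by (metis inner_commute orthogonal_def span_base)
qed

text \<open>The assumption \<open>levi\<close> is the real part of umbilicity on the vectors
  \<open>X - i J X\<close> and \<open>Y - i J Y\<close>, which accounts for the factor 2. Since
  \<open>J\<close> makes the dimension even, \<open>DIM('a) > 4\<close> gives the orthogonal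
  complement of \<open>\<nu> x\<close> and \<open>J (\<nu> x)\<close> real dimension at least
  4.\<close>

locale levi_chart =
  fixes J :: "'a::euclidean_space \<Rightarrow> 'a" and M U :: "'a set" and \<nu> :: "'a \<Rightarrow> 'a"
    and r :: "'a \<Rightarrow> real" and c :: real
  assumes linear_J: "linear J" and J_J [simp]: "J (J x) = - x" and J_inner [simp]: "J x \<bullet> J y = x \<bullet> y"
    and dim: "DIM('a) > 4"
    and open_U: "open U" and smooth_r: "smooth_on U r"
    and gradient: "x \<in> M \<inter> U \<Longrightarrow> ddir v r x = \<nu> x \<bullet> v"
    and unit: "x \<in> M \<inter> U \<Longrightarrow> \<nu> x \<bullet> \<nu> x = 1"
    and curve: "x \<in> M \<inter> U \<Longrightarrow> \<nu> x \<bullet> v = 0 \<Longrightarrow> v \<in> tangent_space M x"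
    and levi: "x \<in> M \<inter> U \<Longrightarrow> \<nu> x \<bullet> X = 0 \<Longrightarrow> J (\<nu> x) \<bullet> X = 0 \<Longrightarrow> \<nu> x \<bullet> Y = 0 \<Longrightarrow> J (\<nu> x) \<bullet> Y = 0 \<Longrightarrow>
      ddir X (ddir Y r) x + ddir (J X) (ddir (J Y) r) x = 2 * c * (X \<bullet> Y)"
    and c_nonzero: "c \<noteq> 0"
begin

section \<open>Derivatives of the chart function up to order four and their symmetries\<close>

definition h :: "'a \<Rightarrow> 'a \<Rightarrow> 'a \<Rightarrow> real" where "h x u v = ddir u (ddir v r) x"
definition C :: "'a \<Rightarrow> 'a \<Rightarrow> 'a \<Rightarrow> 'a \<Rightarrow> real" where "C x u v w = ddir u (ddir v (ddir w r)) x"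
definition Q :: "'a \<Rightarrow> 'a \<Rightarrow> 'a \<Rightarrow> 'a \<Rightarrow> 'a \<Rightarrow> real" where
  "Q x u v w z = ddir u (ddir v (ddir w (ddir z r))) x"

lemmas J_simps [simp] = linear_add[OF linear_J] linear_diff[OF linear_J] linear_neg[OF linear_J]
  linear_cmul[OF linear_J] linear_0[OF linear_J]

lemma J_inner_left: "J x \<bullet> y = - (x \<bullet> J y)"
  using J_inner[of x "J y"] by simp

lemma J_inner_self [simp]: "J x \<bullet> x = 0" "x \<bullet> J x = 0"
  using J_inner_left[of x x] by (simp_all add: inner_commute)

lemma bounded_linear_J: "bounded_linear J"
  using linear_J by (simp add: linear_conv_bounded_linear)

lemma h_sym: "x \<in> U \<Longrightarrow> h x u v = h x v u"
  unfolding h_def by (rule ddir_commute[OF smooth_r open_U])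

lemma C_swap12: "x \<in> U \<Longrightarrow> C x u v w = C x v u w"
  unfolding C_def by (rule ddir_commute[OF smooth_onD(2)[OF smooth_r] open_U])

lemma Q_swap12: "x \<in> U \<Longrightarrow> Q x u v w z = Q x v u w z"
  unfolding Q_def by (rule ddir_commute[OF smooth_onD(2)[OF smooth_onD(2)[OF smooth_r]] open_U])

lemma smooth_h: "smooth_on U (\<lambda>x. h x u v)"
  unfolding h_def by (intro smooth_onD(2) smooth_r)

lemma smooth_C: "smooth_on U (\<lambda>x. C x u v w)"
  unfolding C_def by (intro smooth_onD(2) smooth_r)

lemma C_eq: "C x u v w = ddir u (\<lambda>y. h y v w) x"
  by (simp add: C_def h_def)

lemma Q_eq: "Q x u v w z = ddir u (\<lambda>y. C y v w z) x"
  by (simp add: Q_def C_def)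

lemma ddir_cong_U:
  assumes "x \<in> U" "f differentiable (at x)" "\<And>y. y \<in> U \<Longrightarrow> f y = g y"
  shows "ddir u f x = ddir u g x"
  using frechet_derivative_transform_within_open[OF assms(2) open_U assms(1) assms(3)] by simp

lemma C_swap23: "x \<in> U \<Longrightarrow> C x u v w = C x u w v"
  unfolding C_eq by (intro ddir_cong_U smooth_onD(1)[OF smooth_h] h_sym)

lemma h_linear_left: "x \<in> U \<Longrightarrow> linear (\<lambda>u. h x u v)"
  unfolding h_def by (intro linear_frechet_derivative smooth_onD(1)[OF smooth_onD(2)[OF smooth_r]])

lemma h_linear: "x \<in> U \<Longrightarrow> linear (h x u)"
  using h_linear_left[of x u] by (simp add: h_sym[of x _ u])

lemma C_linear1: "x \<in> U \<Longrightarrow> linear (\<lambda>u. C x u v w)"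
  unfolding C_def by (intro linear_frechet_derivative smooth_onD(1)[OF smooth_onD(2)[OF smooth_onD(2)[OF smooth_r]]])

lemma C_linear2: "x \<in> U \<Longrightarrow> linear (\<lambda>v. C x u v w)"
  using C_linear1[of x u w] by (simp add: C_swap12[of x u])

lemma C_linear3: "x \<in> U \<Longrightarrow> linear (\<lambda>w. C x u v w)"
  using C_linear2[of x u v] by (simp add: C_swap23[of x u v])

lemma Q_linear2: "x \<in> U \<Longrightarrow> linear (\<lambda>v. Q x u v w z)"
proof -
  assume x: "x \<in> U"
  have "linear (\<lambda>v. Q x v u w z)"
    unfolding Q_eq using x by (intro linear_frechet_derivative smooth_onD(1)[OF smooth_C])
  then show ?thesis by (simp add: Q_swap12[OF x, of u])
qed

lemma Q_swap23: "x \<in> U \<Longrightarrow> Q x u v w z = Q x u w v z"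
  unfolding Q_eq by (intro ddir_cong_U smooth_onD(1)[OF smooth_C] C_swap12)

lemma Q_swap34: "x \<in> U \<Longrightarrow> Q x u v w z = Q x u v z w"
  unfolding Q_eq by (intro ddir_cong_U smooth_onD(1)[OF smooth_C] C_swap23)

lemma Q_linear3: "x \<in> U \<Longrightarrow> linear (\<lambda>w. Q x u v w z)"
  using Q_linear2[of x u v z] by (simp add: Q_swap23[of x u v])

lemma Q_linear4: "x \<in> U \<Longrightarrow> linear (\<lambda>z. Q x u v w z)"
  using Q_linear3[of x u v w] by (simp add: Q_swap34[of x u v w])

lemmas h_simps = linear_add[OF h_linear] linear_diff[OF h_linear] linear_neg[OF h_linear]
  linear_cmul[OF h_linear] linear_0[OF h_linear]
  linear_add[OF h_linear_left] linear_diff[OF h_linear_left] linear_neg[OF h_linear_left]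
  linear_cmul[OF h_linear_left] linear_0[OF h_linear_left]

lemmas C_simps = linear_add[OF C_linear1] linear_diff[OF C_linear1] linear_neg[OF C_linear1]
  linear_cmul[OF C_linear1] linear_0[OF C_linear1]
  linear_add[OF C_linear2] linear_diff[OF C_linear2] linear_neg[OF C_linear2]
  linear_cmul[OF C_linear2] linear_0[OF C_linear2]
  linear_add[OF C_linear3] linear_diff[OF C_linear3] linear_neg[OF C_linear3]
  linear_cmul[OF C_linear3] linear_0[OF C_linear3]

text \<open>The Hessian as an operator. On tangent vectors it is the derivative of
  \<open>\<nu>\<close>, that is, the shape operator.\<close>

definition A :: "'a \<Rightarrow> 'a \<Rightarrow> 'a" where "A x u = (\<Sum>b\<in>Basis. h x u b *\<^sub>R b)"

lemma linear_sum_inner: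
  fixes g :: "'a \<Rightarrow> real"
  assumes "linear g"
  shows "(\<Sum>b\<in>Basis. g b *\<^sub>R b) \<bullet> w = g w"
proof -
  have "g w = g (\<Sum>b\<in>Basis. (w \<bullet> b) *\<^sub>R b)" by (simp add: euclidean_representation)
  then show ?thesis
    by (simp add: linear_sum[OF assms] linear_cmul[OF assms] inner_sum_left inner_commute[of w] mult.commute)
qed

lemma A_inner: "x \<in> U \<Longrightarrow> A x u \<bullet> w = h x u w" "x \<in> U \<Longrightarrow> w \<bullet> A x u = h x u w"
  by (simp_all add: A_def linear_sum_inner h_linear inner_commute[of w])

section \<open>Differentiation along the hypersurface\<close>

definition T where "T x = J (\<nu> x)"

abbreviation along where "along p v f D \<equiv> deriv_along M p v f D"

lemma along_h:
  assumes p: "p \<in> M \<inter> U" and X: "along p v X X'" and Y: "along p v Y Y'"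
  shows "along p v (\<lambda>x. h x (X x) (Y x)) (C p v (X p) (Y p) + h p X' (Y p) + h p (X p) Y')"
proof -
  have pU: "p \<in> U" using p by auto
  have 0: "along p v (\<lambda>x. h x u w) (C p v u w)" for u w
    unfolding C_eq by (intro has_derivative_imp_deriv_along has_derivative_ddir smooth_onD(1)[OF smooth_h] pU)
  have 1: "along p v (\<lambda>x. h x u (Y x)) (C p v u (Y p) + h p u Y')" for u
    by (rule deriv_along_linear_arg[OF open_U pU h_linear C_linear3[OF pU] 0 Y])
  have "along p v (\<lambda>x. h x (X x) (Y x)) ((C p v (X p) (Y p) + h p (X p) Y') + h p X' (Y p))"
    using pU by (intro deriv_along_linear_arg[OF open_U pU _ _ 1 X] h_linear_left linear_compose_add C_linear2)
  then show ?thesis by (simp add: algebra_simps)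
qed

lemma along_C:
  assumes p: "p \<in> M \<inter> U" and X: "along p v X X'" and Y: "along p v Y Y'" and Z: "along p v Z Z'"
  shows "along p v (\<lambda>x. C x (X x) (Y x) (Z x))
    (Q p v (X p) (Y p) (Z p) + C p X' (Y p) (Z p) + C p (X p) Y' (Z p) + C p (X p) (Y p) Z')"
proof -
  have pU: "p \<in> U" using p by auto
  have 0: "along p v (\<lambda>x. C x u w z) (Q p v u w z)" for u w z
    unfolding Q_eq by (intro has_derivative_imp_deriv_along has_derivative_ddir smooth_onD(1)[OF smooth_C] pU)
  have 1: "along p v (\<lambda>x. C x u w (Z x)) (Q p v u w (Z p) + C p u w Z')" for u w
    by (rule deriv_along_linear_arg[OF open_U pU C_linear3 Q_linear4[OF pU] 0 Z])
  have 2: "along p v (\<lambda>x. C x u (Y x) (Z x)) ((Q p v u (Y p) (Z p) + C p u (Y p) Z') + C p u Y' (Z p))" for u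
    using pU by (intro deriv_along_linear_arg[OF open_U pU _ _ 1 Y] C_linear2 linear_compose_add Q_linear3)
  have "along p v (\<lambda>x. C x (X x) (Y x) (Z x))
     (((Q p v (X p) (Y p) (Z p) + C p (X p) (Y p) Z') + C p (X p) Y' (Z p)) + C p X' (Y p) (Z p))"
    using pU by (intro deriv_along_linear_arg[OF open_U pU _ _ 2 X] C_linear1 linear_compose_add Q_linear2)
  then show ?thesis by (simp add: algebra_simps)
qed

lemma along_nu:
  assumes p: "p \<in> M \<inter> U"
  shows "along p v \<nu> (A p v)"
proof -
  have pU: "p \<in> U" using p by auto
  have "along p v (\<lambda>x. \<Sum>b\<in>Basis. ddir b r x *\<^sub>R b) (A p v)"
    unfolding A_def h_def
    by (intro deriv_along_sum deriv_along_linear[OF bounded_linear_scaleR_left]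
        has_derivative_imp_deriv_along has_derivative_ddir smooth_onD(1)[OF smooth_onD(2)[OF smooth_r]] pU)
  then show ?thesis
    using open_U pU
    by (rule deriv_along_cong[rotated -1]) (simp add: gradient euclidean_representation)
qed

lemma along_J: "along p v X X' \<Longrightarrow> along p v (\<lambda>x. J (X x)) (J X')"
  by (rule deriv_along_linear[OF bounded_linear_J])

lemma along_T: "p \<in> M \<inter> U \<Longrightarrow> along p v T (J (A p v))"
  unfolding T_def[abs_def] by (intro along_J along_nu)

lemmas along_inner = deriv_along_bilinear[OF bounded_bilinear_inner]
  and along_mult = deriv_along_bilinear[OF bounded_bilinear_mult]
  and along_scaleR = deriv_along_bilinear[OF bounded_bilinear_scaleR]

text \<open>The device by which each pointwise identity on \<open>M\<close> is differentiated: a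
  tangent direction is the velocity of a curve in \<open>M\<close>, so agreement on \<open>M\<close>
  near \<open>p\<close> suffices.\<close>

lemma along_eq:
  assumes p: "p \<in> M \<inter> U" "\<nu> p \<bullet> v = 0" and "\<And>x. x \<in> M \<inter> U \<Longrightarrow> f x = g x"
    and f: "along p v f D" and g: "along p v g E"
  shows "D = E"
proof -
  have "along p v g D"
    using assms(3) f p open_U by (intro deriv_along_cong[of U p M f g]) auto
  note fg = deriv_along_unique[OF _ _ _ this g]
  show ?thesis
    by (rule tangent_space_curve[OF curve[OF p]]) (rule fg)
qed

section \<open>The J-invariant distribution and projected constant fields\<close>

definition H :: "'a \<Rightarrow> 'a set" where "H x = {v. \<nu> x \<bullet> v = 0 \<and> T x \<bullet> v = 0}"

lemma H_D: "X \<in> H p \<Longrightarrow> \<nu> p \<bullet> X = 0" "X \<in> H p \<Longrightarrow> T p \<bullet> X = 0"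
  "X \<in> H p \<Longrightarrow> X \<bullet> \<nu> p = 0" "X \<in> H p \<Longrightarrow> X \<bullet> T p = 0"
  by (auto simp: H_def inner_commute)

lemma J_nu [simp]: "J (\<nu> x) = T x" and J_T [simp]: "J (T x) = - \<nu> x"
  by (simp_all add: T_def)

lemma nu_T [simp]: "\<nu> x \<bullet> T x = 0" "T x \<bullet> \<nu> x = 0"
  by (simp_all add: T_def del: J_nu)

lemma T_T: "x \<in> M \<inter> U \<Longrightarrow> T x \<bullet> T x = 1"
  by (simp add: T_def unit del: J_nu)

lemma H_J: "X \<in> H p \<Longrightarrow> J X \<in> H p"
  by (simp add: H_def inner_commute[of "\<nu> p"] inner_commute[of "T p"] J_inner_left)

lemma H_add: "X \<in> H p \<Longrightarrow> Y \<in> H p \<Longrightarrow> X + Y \<in> H p"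
  and H_diff: "X \<in> H p \<Longrightarrow> Y \<in> H p \<Longrightarrow> X - Y \<in> H p"
  and H_scaleR: "X \<in> H p \<Longrightarrow> a *\<^sub>R X \<in> H p"
  by (simp_all add: H_def inner_add_right inner_diff_right)

lemma tangent_split:
  assumes "p \<in> M \<inter> U" "\<nu> p \<bullet> v = 0"
  obtains w a where "w \<in> H p" "v = w + a *\<^sub>R T p"
proof
  show "v - (T p \<bullet> v) *\<^sub>R T p \<in> H p"
    using assms by (simp add: H_def inner_diff_right T_T)
  show "v = (v - (T p \<bullet> v) *\<^sub>R T p) + (T p \<bullet> v) *\<^sub>R T p" by simp
qed

lemma levi_h: "p \<in> M \<inter> U \<Longrightarrow> X \<in> H p \<Longrightarrow> Y \<in> H p \<Longrightarrow> h p X Y + h p (J X) (J Y) = 2 * c * (X \<bullet> Y)"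
  using levi[of p X Y] by (simp add: h_def H_def)

lemma levi_h_J: "p \<in> M \<inter> U \<Longrightarrow> X \<in> H p \<Longrightarrow> Y \<in> H p \<Longrightarrow> h p X (J Y) - h p (J X) Y = 2 * c * (X \<bullet> J Y)"
  using levi_h[of p X "J Y"] by (simp add: H_J h_simps)

text \<open>Extends a vector of \<open>H p\<close> to a field with values in \<open>H x\<close>. As
  the constant field is only projected, the derivative \<open>dproj\<close> at \<open>p\<close> has
  no component in \<open>H p\<close>.\<close>

definition proj :: "'a \<Rightarrow> 'a \<Rightarrow> 'a" where "proj X x = X - (X \<bullet> \<nu> x) *\<^sub>R \<nu> x - (X \<bullet> T x) *\<^sub>R T x"

definition dproj :: "'a \<Rightarrow> 'a \<Rightarrow> 'a \<Rightarrow> 'a" where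
  "dproj p v X = - (X \<bullet> A p v) *\<^sub>R \<nu> p - (X \<bullet> J (A p v)) *\<^sub>R T p"

lemma proj_H: "x \<in> M \<inter> U \<Longrightarrow> proj X x \<in> H x"
  by (simp add: proj_def H_def inner_diff_right inner_commute[of X] unit T_T)

lemma proj_id [simp]: "X \<in> H p \<Longrightarrow> proj X p = X"
  by (simp add: proj_def H_D)

lemma along_proj:
  assumes p: "p \<in> M \<inter> U" and X: "X \<in> H p"
  shows "along p v (proj X) (dproj p v X)"
proof -
  have "along p v (proj X) (0 - ((X \<bullet> \<nu> p) *\<^sub>R A p v + (X \<bullet> A p v + 0 \<bullet> \<nu> p) *\<^sub>R \<nu> p)
      - ((X \<bullet> T p) *\<^sub>R J (A p v) + (X \<bullet> J (A p v) + 0 \<bullet> T p) *\<^sub>R T p))"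
    unfolding proj_def[abs_def]
    by (intro deriv_along_diff deriv_along_const along_scaleR along_inner along_nu[OF p] along_T[OF p])
  then show ?thesis by (simp add: dproj_def H_D[OF X])
qed

text \<open>The derivative of the constant \<open>\<nu> x \<bullet> \<nu> x\<close> along
  \<open>M\<close>.\<close>

lemma h_nu:
  assumes p: "p \<in> M \<inter> U" "\<nu> p \<bullet> v = 0"
  shows "h p v (\<nu> p) = 0" "h p (\<nu> p) v = 0"
proof -
  have "along p v (\<lambda>x. \<nu> x \<bullet> \<nu> x) (\<nu> p \<bullet> A p v + A p v \<bullet> \<nu> p)"
    by (intro along_inner along_nu p)
  from along_eq[OF p _ this deriv_along_const[of _ _ _ 1]]
  show "h p v (\<nu> p) = 0" using p unit by (simp add: A_inner)
  then show "h p (\<nu> p) v = 0" using p h_sym by auto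
qed

text \<open>The \<open>\<nu>\<close> component of the derivative of the extension is killed by
  \<open>h_nu\<close>; the \<open>T\<close> component is what remains.\<close>

lemma h_dproj:
  assumes p: "p \<in> M \<inter> U" and Y: "\<nu> p \<bullet> Y = 0" and X: "X \<in> H p"
  shows "h p (dproj p v X) Y = h p v (J X) * h p (T p) Y"
    "h p (J (dproj p v X)) Y = - (h p v X * h p (T p) Y)"
    "h p Y (dproj p v X) = h p v (J X) * h p (T p) Y"
    "h p Y (J (dproj p v X)) = - (h p v X * h p (T p) Y)"
proof -
  have "X \<bullet> J (A p v) = - h p v (J X)" "X \<bullet> A p v = h p v X"
    using p J_inner_left[of X "A p v"] by (auto simp: A_inner)
  then show 1: "h p (dproj p v X) Y = h p v (J X) * h p (T p) Y"
    and 2: "h p (J (dproj p v X)) Y = - (h p v X * h p (T p) Y)"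
    using p h_nu[OF p Y] by (simp_all add: dproj_def h_simps)
  show "h p Y (dproj p v X) = h p v (J X) * h p (T p) Y"
    "h p Y (J (dproj p v X)) = - (h p v X * h p (T p) Y)"
    using 1 2 p h_sym[of p Y] by auto
qed

lemma dproj_inner: "Y \<in> H p \<Longrightarrow> dproj p v X \<bullet> Y = 0" "Y \<in> H p \<Longrightarrow> Y \<bullet> dproj p v X = 0"
  by (simp_all add: dproj_def inner_diff_left inner_diff_right H_D)

text \<open>Umbilicity differentiated on projected fields. The metric side contributes nothing
  because \<open>dproj\<close> is orthogonal to \<open>H\<close>, and every correction term carries
  a factor \<open>h (T, _)\<close>.\<close>

lemma levi_derivative:
  assumes p: "p \<in> M \<inter> U" "\<nu> p \<bullet> v = 0" and X: "X \<in> H p" and Y: "Y \<in> H p"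
  shows "C p v X Y + C p v (J X) (J Y) + h p v (J X) * h p (T p) Y + h p v (J Y) * h p (T p) X
    - h p v X * h p (T p) (J Y) - h p v Y * h p (T p) (J X) = 0"
proof -
  note X' = along_proj[OF p(1) X, of v] and Y' = along_proj[OF p(1) Y, of v]
  note D = along_eq[OF p _
    deriv_along_add[OF along_h[OF p(1) X' Y'] along_h[OF p(1) along_J[OF X'] along_J[OF Y']]]
    along_mult[OF deriv_along_const[of M p v "2 * c"] along_inner[OF X' Y']]]
  from D show ?thesis
    using X Y H_J[OF X] H_J[OF Y] p
    by (simp add: levi_h proj_H dproj_inner h_dproj H_D)
qed

text \<open>A second direction \<open>e\<close> in \<open>H\<close>, orthogonal to both
  \<open>X\<close> and \<open>J X\<close>, is where the real dimension 4 of \<open>H\<close> enters.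
  Three instances of \<open>levi_derivative\<close> then share their third derivatives.\<close>

lemma h_T_H:
  assumes p: "p \<in> M \<inter> U" and X: "X \<in> H p"
  shows "h p (T p) X = 0" "h p X (T p) = 0"
proof -
  have pU: "p \<in> U" using p by auto
  have *: "h p (T p) (J X) = 0" if X: "X \<in> H p" for X
  proof -
    obtain e where e: "e \<noteq> 0" "\<And>y. y \<in> set [\<nu> p, T p, X, J X] \<Longrightarrow> y \<bullet> e = 0"
      using orthogonal_to_list_exists[of "[\<nu> p, T p, X, J X]"] dim by auto
    have eH: "e \<in> H p" "e \<bullet> X = 0" "e \<bullet> J X = 0"
      using e(2)[of "\<nu> p"] e(2)[of "T p"] e(2)[of X] e(2)[of "J X"]
      by (simp_all add: H_def inner_commute[of e])
    have JH: "J X \<in> H p" "J e \<in> H p" using H_J X eH by auto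
    have t: "\<nu> p \<bullet> e = 0" "\<nu> p \<bullet> X = 0" "\<nu> p \<bullet> J e = 0" "\<nu> p \<bullet> J X = 0"
      using eH X JH by (auto simp: H_D)
    note E1 = levi_derivative[OF p t(1) X eH(1)] and E2 = levi_derivative[OF p t(2) eH(1) eH(1)]
      and E3 = levi_derivative[OF p t(3) JH(1) eH(1)]
    have h1: "h p e (J X) = h p X (J e)" "h p (J e) X = h p X (J e)" "h p (J X) e = h p X (J e)"
      using levi_h_J[OF p eH(1) X] eH h_sym[OF pU] by auto
    have h2: "h p (J X) (J e) = - h p X e" "h p (J e) (J X) = - h p X e" "h p e X = h p X e"
      using levi_h[OF p X eH(1)] eH h_sym[OF pU] by (auto simp: inner_commute)
    have h3: "h p (J e) e = h p e (J e)" using h_sym[OF pU] .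
    have h4: "h p (J e) (J e) = 2 * c * (e \<bullet> e) - h p e e"
      using levi_h[OF p eH(1) eH(1)] by simp
    have C: "C p X e e = C p e X e" "C p (J e) (J X) e = C p e (J X) (J e)" "C p X (J e) (J e) = C p (J e) X (J e)"
      "C p (J X) (J e) e = C p e (J X) (J e)" "C p (J X) e (J e) = C p e (J X) (J e)"
      by (metis C_swap12 C_swap23 pU)+
    \<comment> \<open>In \<open>E1 - E2 - E3\<close> all third derivatives cancel by symmetry, and
      so do the terms with \<open>h (T, e)\<close>, \<open>h (T, X)\<close> and
      \<open>h (T, J e)\<close>. The coefficient of \<open>h (T, J X)\<close> is
      \<open>- (h (e, e) + h (J e, J e))\<close>, fixed by umbilicity.\<close>
    have "2 * c * (e \<bullet> e) * h p (T p) (J X) = 0"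
      using E1 E2 E3 unfolding h1 h2 h3 h4 C J_J C_simps[OF pU] h_simps[OF pU] by algebra
    then show ?thesis using c_nonzero e(1) by simp
  qed
  from *[OF H_J[OF X]] show "h p (T p) X = 0" by (simp add: h_simps pU)
  then show "h p X (T p) = 0" using h_sym[OF pU] by simp
qed

section \<open>The shape operator and its quadratic relation\<close>

lemma linear_A: "x \<in> U \<Longrightarrow> linear (A x)"
  by (rule linearI)
    (simp_all add: A_def h_simps scaleR_add_left sum.distrib scaleR_sum_right)

lemmas A_simps = linear_add[OF linear_A] linear_diff[OF linear_A] linear_neg[OF linear_A]
  linear_cmul[OF linear_A] linear_0[OF linear_A]

lemma along_A:
  assumes p: "p \<in> M \<inter> U" and X: "along p v X X'"
  shows "along p v (\<lambda>x. A x (X x)) ((\<Sum>b\<in>Basis. C p v (X p) b *\<^sub>R b) + A p X')"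
proof -
  have pU: "p \<in> U" using p by auto
  have "along p v (\<lambda>x. A x (X x)) (\<Sum>b\<in>Basis. (C p v (X p) b + h p X' b + h p (X p) 0) *\<^sub>R b)"
    unfolding A_def
    by (intro deriv_along_sum deriv_along_linear[OF bounded_linear_scaleR_left]
        along_h[OF p X] deriv_along_const)
  then show ?thesis
    by (simp add: A_def h_simps[OF pU] scaleR_add_left sum.distrib)
qed

lemma C_vec_inner:
  assumes "x \<in> U"
  shows "(\<Sum>b\<in>Basis. C x u v b *\<^sub>R b) \<bullet> w = C x u v w" "w \<bullet> (\<Sum>b\<in>Basis. C x u v b *\<^sub>R b) = C x u v w"
  using linear_sum_inner[OF C_linear3[OF assms, of u v], of w] by (simp_all add: inner_commute)

text \<open>By \<open>A_T\<close> below this is the principal curvature in the direction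
  \<open>T\<close>.\<close>

definition lam :: "'a \<Rightarrow> real" where "lam x = h x (T x) (T x)"

lemma H_eqI:
  assumes "u \<in> H p" "w \<in> H p" "\<And>W. W \<in> H p \<Longrightarrow> u \<bullet> W = w \<bullet> W"
  shows "u = w"
proof -
  have "(u - w) \<bullet> (u - w) = 0"
    using assms(3)[OF H_diff[OF assms(1,2)]] by (subst inner_diff_left) simp
  then show ?thesis by simp
qed

lemma A_H:
  assumes p: "p \<in> M \<inter> U" and X: "X \<in> H p"
  shows "A p X \<in> H p"
  using p X h_nu(1)[OF p] h_T_H(2)[OF p X] by (auto simp: H_def A_inner)

lemma A_T:
  assumes p: "p \<in> M \<inter> U"
  shows "A p (T p) = lam p *\<^sub>R T p"
proof -
  have pU: "p \<in> U" using p by auto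
  let ?w = "A p (T p) - lam p *\<^sub>R T p"
  have w: "?w \<in> H p"
    using h_nu(1)[OF p] by (simp add: H_def A_inner[OF pU] inner_diff_right T_T[OF p] lam_def)
  have "?w \<bullet> ?w = 0"
    using h_T_H(1)[OF p w] H_D[OF w] by (subst inner_diff_left) (simp add: A_inner[OF pU])
  then show ?thesis by simp
qed

text \<open>Differentiating \<open>h (T, X) = 0\<close> along \<open>V\<close> gives
  \<open>C (V, T, X) = - A X \<bullet> J (A V) - lam h (V, J X)\<close>. The left side is symmetric
  in \<open>V\<close> and \<open>X\<close>, the first term on the right is skew, so exchanging the
  two vectors isolates both.\<close>

lemma AJA:
  assumes p: "p \<in> M \<inter> U" and X: "X \<in> H p" and V: "V \<in> H p"
  shows C_HTH: "C p V (T p) X = c * lam p * (V \<bullet> J X) - lam p * h p V (J X)"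
    and "A p X \<bullet> J (A p V) = - c * lam p * (V \<bullet> J X)"
proof -
  have pU: "p \<in> U" using p by auto
  have 1: "C p V (T p) X = - (A p X \<bullet> J (A p V)) - lam p * h p V (J X)"
    if X: "X \<in> H p" and V: "V \<in> H p" for X V
  proof -
    from along_eq[OF p _ _ along_h[OF p along_T[OF p] along_proj[OF p X]] deriv_along_const[of _ _ _ 0], of V]
    have "C p V (T p) X + h p (J (A p V)) X + h p (T p) (dproj p V X) = 0"
      using h_T_H(1)[OF _ proj_H] H_D[OF V] X by simp
    moreover have "h p (J (A p V)) X = A p X \<bullet> J (A p V)"
      by (simp add: A_inner[OF pU] h_sym[OF pU])
    moreover have "h p (T p) (dproj p V X) = h p V (J X) * lam p"
      using h_dproj(3)[OF p _ X, of "T p"] by (simp add: lam_def)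
    ultimately show ?thesis by (simp add: algebra_simps)
  qed
  have "C p V (T p) X = C p X (T p) V"
    by (metis C_swap12 C_swap23 pU)
  moreover have "A p V \<bullet> J (A p X) = - (A p X \<bullet> J (A p V))"
    using J_inner_left[of "A p X" "A p V"] by (simp add: inner_commute)
  moreover have "h p V (J X) - h p X (J V) = 2 * c * (V \<bullet> J X)"
    using levi_h_J[OF p V X] h_sym[OF pU] by simp
  ultimately show 2: "A p X \<bullet> J (A p V) = - c * lam p * (V \<bullet> J X)"
    using 1[OF X V] 1[OF V X] by algebra
  show "C p V (T p) X = c * lam p * (V \<bullet> J X) - lam p * h p V (J X)"
    using 1[OF X V] 2 by simp
qed

text \<open>Umbilicity as an operator identity, obtained by moving one \<open>J\<close> across the
  inner product.\<close>

lemma A_J: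
  assumes p: "p \<in> M \<inter> U" and X: "X \<in> H p"
  shows "J (A p (J X)) = A p X - (2 * c) *\<^sub>R X" "A p (J X) = (2 * c) *\<^sub>R J X - J (A p X)"
proof -
  have pU: "p \<in> U" using p by auto
  show 1: "J (A p (J X)) = A p X - (2 * c) *\<^sub>R X"
  proof (rule H_eqI)
    fix W assume W: "W \<in> H p"
    show "J (A p (J X)) \<bullet> W = (A p X - (2 * c) *\<^sub>R X) \<bullet> W"
      using levi_h[OF p X W] by (simp add: J_inner_left[of "A p (J X)"] A_inner[OF pU] inner_diff_left)
  qed (use p X in \<open>auto intro!: A_H H_J H_diff H_scaleR\<close>)
  show "A p (J X) = (2 * c) *\<^sub>R J X - J (A p X)"
    using arg_cong[OF 1, of J] by (simp add: algebra_simps)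
qed

text \<open>This is \<open>AJA\<close> with \<open>V = J Y\<close>, where \<open>A_J\<close>
  rewrites \<open>J (A (J Y))\<close>. The bilinear form is the one that is later differentiated on
  projected fields.\<close>

lemma A_sq:
  assumes p: "p \<in> M \<inter> U" and X: "X \<in> H p" and Y: "Y \<in> H p"
  shows "A p X \<bullet> A p Y = 2 * c * h p X Y - c * (lam p * (X \<bullet> Y))"
  using AJA(2)[OF p X H_J[OF Y]] p
  by (auto simp: A_J(1)[OF p Y] inner_diff_right A_inner inner_commute)

lemma A_A:
  assumes p: "p \<in> M \<inter> U" and X: "X \<in> H p"
  shows "A p (A p X) = (2 * c) *\<^sub>R A p X - (c * lam p) *\<^sub>R X"
proof (rule H_eqI)
  have pU: "p \<in> U" using p by auto
  fix W assume W: "W \<in> H p"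
  have "A p (A p X) \<bullet> W = A p X \<bullet> A p W"
    by (simp add: A_inner[OF pU] h_sym[OF pU, of W])
  then show "A p (A p X) \<bullet> W = ((2 * c) *\<^sub>R A p X - (c * lam p) *\<^sub>R X) \<bullet> W"
    using A_sq[OF p X W] by (simp add: A_inner(1)[OF pU] inner_diff_left)
qed (use p X in \<open>auto intro!: A_H H_diff H_scaleR\<close>)

lemma A_minus_c_sq:
  assumes p: "p \<in> M \<inter> U" and X: "X \<in> H p"
  shows "A p (A p X - c *\<^sub>R X) - c *\<^sub>R (A p X - c *\<^sub>R X) = (c * (c - lam p)) *\<^sub>R X"
proof -
  have pU: "p \<in> U" using p by auto
  have "(2 * c) *\<^sub>R A p X = c *\<^sub>R A p X + c *\<^sub>R A p X"
    by (metis mult_2 scaleR_add_left)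
  then show ?thesis
    by (simp add: A_simps[OF pU] A_A[OF p X] algebra_simps)
qed

section \<open>The third derivative on tangent vectors\<close>

lemma h_dproj_H:
  assumes p: "p \<in> M \<inter> U" and X: "X \<in> H p" and Y: "Y \<in> H p"
  shows "h p (dproj p v X) Y = 0" "h p Y (dproj p v X) = 0"
  using h_dproj(1,3)[OF p _ X, of Y v] h_T_H(1)[OF p Y] H_D(1)[OF Y] by auto

lemma C_TTH:
  assumes p: "p \<in> M \<inter> U" and X: "X \<in> H p"
  shows "C p (T p) (T p) X = 0"
proof -
  have pU: "p \<in> U" using p by auto
  from along_eq[OF p _ _ along_h[OF p along_T[OF p] along_proj[OF p X]] deriv_along_const[of _ _ _ 0], of "T p"]
  have "C p (T p) (T p) X + h p (J (A p (T p))) X + h p (T p) (dproj p (T p) X) = 0"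
    using h_T_H(1)[OF _ proj_H] X by simp
  then show ?thesis
    using h_dproj(3)[OF p _ X, of "T p" "T p"] h_nu[OF p H_D(1)[OF X]] h_T_H(1)[OF p H_J[OF X]]
    by (simp add: A_T[OF p] h_simps[OF pU])
qed

lemma ex_H:
  obtains X where "X \<in> H p" "X \<noteq> 0"
proof -
  obtain X where X: "X \<noteq> 0" "\<And>y. y \<in> set [\<nu> p, T p] \<Longrightarrow> y \<bullet> X = 0"
    using orthogonal_to_list_exists[of "[\<nu> p, T p]"] dim by auto
  have "X \<in> H p"
    using X(2) by (simp add: H_def)
  with X that show ?thesis by blast
qed

lemma along_lam_C:
  assumes p: "p \<in> M \<inter> U" "\<nu> p \<bullet> v = 0"
  shows "along p v lam (C p v (T p) (T p))"
proof -
  have pU: "p \<in> U" using p by auto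
  have "h p (T p) (J (A p v)) = lam p * (T p \<bullet> J (A p v))"
    using A_T[OF p(1)] A_inner(1)[OF pU, of "T p" "J (A p v)"] by simp
  also have "T p \<bullet> J (A p v) = h p v (\<nu> p)"
    by (simp add: T_def A_inner[OF pU] del: J_nu)
  finally have "h p (T p) (J (A p v)) = 0"
    using h_nu(1)[OF p] by simp
  then show ?thesis
    using along_h[OF p(1) along_T[OF p(1), of v] along_T[OF p(1), of v]]
    by (simp add: lam_def[abs_def] h_sym[OF pU, of "J (A p v)"])
qed

text \<open>Along \<open>T\<close> this follows from differentiating the quadratic relation for the shape operator.\<close>

lemma C_TTT:
  assumes p: "p \<in> M \<inter> U"
  shows "C p (T p) (T p) (T p) = 0"
proof -
  have pU: "p \<in> U" using p by auto
  obtain X where X: "X \<in> H p" "X \<noteq> 0" by (rule ex_H)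
  have "dproj p (T p) X = 0"
    by (simp add: dproj_def A_T[OF p] H_D[OF X(1)])
  then have P: "along p (T p) (proj X) 0"
    using along_proj[OF p X(1), of "T p"] by simp
  have "along p (T p) (\<lambda>x. A x (proj X x) \<bullet> A x (proj X x)) (2 * C p (T p) X (A p X))"
    using along_inner[OF along_A[OF p P] along_A[OF p P]]
    by (simp add: X A_simps[OF pU] C_vec_inner[OF pU])
  moreover have "along p (T p) (\<lambda>x. 2 * c * h x (proj X x) (proj X x) - c * (lam x * (proj X x \<bullet> proj X x)))
      (2 * c * C p (T p) X X - c * (C p (T p) (T p) (T p) * (X \<bullet> X)))"
    using deriv_along_diff[OF along_mult[OF deriv_along_const[of _ _ _ "2 * c"] along_h[OF p P P]]
        along_mult[OF deriv_along_const[of _ _ _ c] along_mult[OF along_lam_C[OF p nu_T(1)] along_inner[OF P P]]]]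
    by (simp add: X h_simps[OF pU])
  ultimately have "2 * C p (T p) X (A p X) = 2 * c * C p (T p) X X - c * (C p (T p) (T p) (T p) * (X \<bullet> X))"
    by (rule along_eq[OF p nu_T(1), rotated]) (simp add: A_sq proj_H)
  moreover have "C p (T p) X Y = c * lam p * (X \<bullet> J Y) - lam p * h p X (J Y)" if "Y \<in> H p" for Y
    using C_HTH[OF p that X(1)] C_swap12[OF pU] by simp
  moreover have "h p X (J (A p X)) = 0"
    using A_inner(1)[OF pU, of X "J (A p X)"] by simp
  moreover have "X \<bullet> J (A p X) = - h p X (J X)"
    using J_inner_left[of X "A p X"] by (simp add: A_inner[OF pU])
  \<comment> \<open>Both \<open>2 C (T, X, A X)\<close> and \<open>2 c C (T, X, X)\<close> equal
    \<open>- 2 c lam h (X, J X)\<close>, so only the term with \<open>C (T, T, T)\<close> is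
    left.\<close>
  ultimately have "c * (C p (T p) (T p) (T p) * (X \<bullet> X)) = 0"
    using X(1) A_H[OF p X(1)] by (simp add: algebra_simps)
  then show ?thesis using X c_nonzero by simp
qed

lemma along_lam:
  assumes p: "p \<in> M \<inter> U" "\<nu> p \<bullet> v = 0"
  shows "along p v lam 0"
proof -
  have pU: "p \<in> U" using p by auto
  obtain w a where w: "w \<in> H p" "v = w + a *\<^sub>R T p"
    using tangent_split[OF p] .
  have "C p w (T p) (T p) = C p (T p) (T p) w"
    by (metis C_swap12 C_swap23 pU)
  then have "C p v (T p) (T p) = 0"
    using C_TTH[OF p(1) w(1)] C_TTT[OF p(1)] by (simp add: w(2) C_simps[OF pU])
  with along_lam_C[OF p] show ?thesis by simp
qed

text \<open>Since \<open>lam\<close> is constant, differentiating \<open>A_sq\<close> along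
  \<open>V\<close> makes \<open>C (V, X, B Y)\<close> with \<open>B = A - c\<close> skew in
  \<open>X\<close> and \<open>Y\<close>. It is also symmetric in \<open>V\<close> and
  \<open>X\<close>, and such a trilinear form vanishes. For \<open>lam \<noteq> c\<close> the
  operator \<open>B\<close> is invertible on \<open>H\<close>, its square being a non-zero
  scalar.\<close>

lemma C_HHH:
  assumes p: "p \<in> M \<inter> U" and lam: "lam p \<noteq> c"
    and V: "V \<in> H p" and X: "X \<in> H p" and Y: "Y \<in> H p"
  shows "C p V X Y = 0"
proof -
  have pU: "p \<in> U" using p by auto
  define B where "B Y = A p Y - c *\<^sub>R Y" for Y
  have BH: "B Y \<in> H p" if "Y \<in> H p" for Y
    using that p by (auto simp: B_def intro!: H_diff H_scaleR A_H)
  have skew: "C p V X (B Y) = - C p V Y (B X)"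
    if V: "V \<in> H p" and X: "X \<in> H p" and Y: "Y \<in> H p" for V X Y
  proof -
    note X' = along_proj[OF p X, of V] and Y' = along_proj[OF p Y, of V]
    have 1: "along p V (\<lambda>x. A x (proj X x) \<bullet> A x (proj Y x)) (C p V Y (A p X) + C p V X (A p Y))"
      using along_inner[OF along_A[OF p X'] along_A[OF p Y']] A_H[OF p X] A_H[OF p Y]
      by (simp add: X Y inner_add_left inner_add_right C_vec_inner[OF pU] A_inner(1)[OF pU]
          h_dproj_H[OF p] inner_commute[of _ "A p (dproj p V Y)"])
    have 2: "along p V (\<lambda>x. 2 * c * h x (proj X x) (proj Y x) - c * (lam x * (proj X x \<bullet> proj Y x)))
        (2 * c * C p V X Y)"
      using deriv_along_diff[OF along_mult[OF deriv_along_const[of _ _ _ "2 * c"] along_h[OF p X' Y']]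
          along_mult[OF deriv_along_const[of _ _ _ c] along_mult[OF along_lam[OF p H_D(1)[OF V]] along_inner[OF X' Y']]]]
      by (simp add: X Y h_dproj_H[OF p] dproj_inner)
    have "C p V Y (A p X) + C p V X (A p Y) = 2 * c * C p V X Y"
      by (rule along_eq[OF p H_D(1)[OF V] _ 1 2]) (simp add: A_sq proj_H)
    then show ?thesis
      using C_swap23[OF pU, of V Y X] by (simp add: B_def C_simps[OF pU])
  qed
  have zero: "C p V X (B Y) = 0" if "V \<in> H p" "X \<in> H p" "Y \<in> H p" for V X Y
    using skew[OF that] skew[of Y V X] skew[of X Y V] that C_swap12[OF pU] by simp
  have "B (B Y) = (c * (c - lam p)) *\<^sub>R Y"
    using A_minus_c_sq[OF p Y] by (simp add: B_def)
  then have "c * (c - lam p) * C p V X Y = 0"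
    using zero[OF V X BH[OF Y]] by (simp add: C_simps[OF pU])
  then show ?thesis using lam c_nonzero by simp
qed

text \<open>The derivative of \<open>h (\<nu>, X) = 0\<close> along an eigenvector \<open>X\<close>;
  the term with \<open>h (\<nu>, \<nu>)\<close> comes from the turning of \<open>H\<close>.\<close>

lemma C_nu:
  assumes p: "p \<in> M \<inter> U" and X: "X \<in> H p" and A: "A p X = a *\<^sub>R X"
  shows "C p X (\<nu> p) X = (a * h p (\<nu> p) (\<nu> p) - a\<^sup>2) * (X \<bullet> X)"
proof -
  have pU: "p \<in> U" using p by auto
  from along_eq[OF p _ _ along_h[OF p along_nu[OF p] along_proj[OF p X]] deriv_along_const[of _ _ _ 0], of X]
  have "C p X (\<nu> p) X + h p (A p X) X + h p (\<nu> p) (dproj p X X) = 0"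
    using h_nu(2)[OF _ H_D(1)[OF proj_H]] H_D[OF X] X by simp
  moreover have "h p X X = a * (X \<bullet> X)"
    using A_inner(1)[OF pU, of X X] A by simp
  moreover have "h p (\<nu> p) (dproj p X X) = - (a * (X \<bullet> X) * h p (\<nu> p) (\<nu> p))"
    using h_nu(2)[OF p nu_T(1)] by (simp add: dproj_def A h_simps[OF pU])
  ultimately show ?thesis
    by (simp add: A h_simps[OF pU] power2_eq_square algebra_simps)
qed

text \<open>The two principal curvatures on \<open>H\<close> are \<open>c + s\<close> and \<open>c - s\<close>, exchanged by \<open>J\<close>.
  Computing the fourth derivative \<open>Q (e, J e, J e, e)\<close> from the vanishing of \<open>C\<close> on \<open>H\<close> in two
  orders yields \<open>6 c s lam = 0\<close>.\<close>

lemma lam_eq_0: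
  assumes p: "p \<in> M \<inter> U" and lam: "\<And>x. x \<in> M \<inter> U \<Longrightarrow> lam x \<noteq> c"
  shows "lam p = 0"
proof -
  have pU: "p \<in> U" using p by auto
  define s where "s = sqrt (c * (c - lam p))"
  define B where "B Y = A p Y - c *\<^sub>R Y" for Y
  obtain X where X: "X \<in> H p" "X \<noteq> 0" by (rule ex_H)
  have BB: "B (B Y) = (c * (c - lam p)) *\<^sub>R Y" if Y: "Y \<in> H p" for Y
    using A_minus_c_sq[OF p Y] by (simp add: B_def)
  have BH: "B Y \<in> H p" if "Y \<in> H p" for Y
    using that p by (auto simp: B_def intro!: H_diff H_scaleR A_H)
  \<comment> \<open>\<open>B\<close> is symmetric with scalar square on \<open>H\<close>, so the
    scalar is non-negative and \<open>s\<close> is a genuine square root.\<close>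
  have "B X \<bullet> B X = c * (c - lam p) * (X \<bullet> X)"
    using A_sq[OF p X(1) X(1)]
    by (simp add: B_def inner_diff_left inner_diff_right A_inner[OF pU] h_simps[OF pU] algebra_simps)
  then have "0 \<le> c * (c - lam p) * (X \<bullet> X)"
    by (metis inner_ge_zero)
  moreover have "X \<bullet> X > 0" using X(2) by simp
  ultimately have "c * (c - lam p) \<ge> 0"
    by (meson mult_neg_pos not_le)
  then have s: "s * s = c * (c - lam p)" "s \<noteq> 0"
    using lam[OF p] c_nonzero by (auto simp: s_def)
  \<comment> \<open>As \<open>(B - s) (B + s) = 0\<close>, the vector \<open>B X + s X\<close> is an
    eigenvector for \<open>s\<close> unless it is zero; in that case \<open>J X\<close> is one,
    because \<open>J\<close> reverses the sign of \<open>B\<close>.\<close>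
  have "\<exists>Y. Y \<in> H p \<and> Y \<noteq> 0 \<and> B Y = s *\<^sub>R Y"
  proof (cases "B X = - s *\<^sub>R X")
    case True
    then have "A p X = (c - s) *\<^sub>R X"
      by (simp add: B_def algebra_simps)
    then have "A p (J X) = (2 * c - (c - s)) *\<^sub>R J X"
      by (simp only: A_J(2)[OF p X(1)] J_simps scaleR_diff_left)
    then have "B (J X) = s *\<^sub>R J X"
      by (simp add: B_def algebra_simps)
    then show ?thesis
      using X H_J[OF X(1)] J_J[of X] by (intro exI[of _ "J X"]) (auto simp del: J_J)
  next
    case False
    have "B (B X + s *\<^sub>R X) = B (B X) + s *\<^sub>R B X"
      by (simp add: B_def A_simps[OF pU] algebra_simps)
    then have "B (B X + s *\<^sub>R X) = s *\<^sub>R (B X + s *\<^sub>R X)"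
      by (simp add: BB[OF X(1)] s(1) scaleR_add_right add.commute)
    moreover have "B X + s *\<^sub>R X \<noteq> 0"
      using False by (metis add_eq_0_iff2 scaleR_minus_left)
    ultimately show ?thesis
      using X BH[OF X(1)] by (intro exI[of _ "B X + s *\<^sub>R X"]) (auto intro: H_add H_scaleR)
  qed
  then obtain Y where Y: "Y \<in> H p" "Y \<noteq> 0" "B Y = s *\<^sub>R Y" by blast
  define e where "e = (1 / norm Y) *\<^sub>R Y"
  have e: "e \<in> H p" "e \<bullet> e = 1" "A p e = (c + s) *\<^sub>R e"
  proof -
    show "e \<in> H p" using Y by (simp add: e_def H_scaleR)
    show "e \<bullet> e = 1" using Y by (simp add: e_def dot_square_norm power2_eq_square)
    have "A p Y = (c + s) *\<^sub>R Y" using Y(3) by (simp add: B_def algebra_simps)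
    then show "A p e = (c + s) *\<^sub>R e" by (simp add: e_def A_simps[OF pU])
  qed
  have "A p (J e) = (2 * c - (c + s)) *\<^sub>R J e"
    using A_J(2)[OF p e(1)] e(3) by (simp only: J_simps scaleR_diff_left)
  then have Je: "J e \<in> H p" "A p (J e) = (c - s) *\<^sub>R J e"
    using H_J[OF e(1)] by simp_all
  have d: "dproj p e (J e) = - (c + s) *\<^sub>R T p" "dproj p e e = - (c + s) *\<^sub>R \<nu> p"
    "dproj p (J e) e = (c - s) *\<^sub>R T p" "dproj p (J e) (J e) = - (c - s) *\<^sub>R \<nu> p"
    using e Je by (simp_all add: dproj_def flip: scaleR_minus_left)
  \<comment> \<open>The vanishing is about to be differentiated, hence needed at every point of the
    chart and not only at \<open>p\<close>.\<close>
  have C0: "C x u v w = 0" if "x \<in> M \<inter> U" "u \<in> H x" "v \<in> H x" "w \<in> H x" for x u v w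
    using C_HHH[OF that(1) lam[OF that(1)]] that by blast
  \<comment> \<open>\<open>C (J e, J e, e) = 0\<close> is differentiated along \<open>e\<close>, and
    \<open>C (e, J e, e) = 0\<close> along \<open>J e\<close>; by symmetry the same \<open>Q\<close>
    appears in both.\<close>
  note Pe = along_proj[OF p e(1)] and PJ = along_proj[OF p Je(1)]
  from along_eq[OF p H_D(1)[OF e(1)] _ along_C[OF p PJ PJ Pe] deriv_along_const[of _ _ _ 0]]
  have 1: "Q p e (J e) (J e) e - 2 * (c + s) * C p (T p) (J e) e - (c + s) * C p (J e) (J e) (\<nu> p) = 0"
    by (simp add: C0 proj_H e Je d C_simps[OF pU] C_swap12[OF pU, of "J e" "T p"])
      (simp add: algebra_simps)
  from along_eq[OF p H_D(1)[OF Je(1)] _ along_C[OF p Pe PJ Pe] deriv_along_const[of _ _ _ 0]]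
  have 2: "Q p (J e) e (J e) e + 2 * (c - s) * C p (T p) (J e) e - (c - s) * C p e (\<nu> p) e = 0"
    using C_swap23[OF pU, of e "J e" "T p"] C_swap12[OF pU, of e "T p" "J e"] C_swap23[OF pU, of "T p" e "J e"]
    by (simp add: C0 proj_H e Je d C_simps[OF pU]) (simp add: algebra_simps)
  have hee: "h p e e = c + s"
    using A_inner(1)[OF pU, of e e] e by simp
  have 3: "C p (T p) (J e) e = lam p * s"
    using C_HTH[OF p Je(1) e(1)] C_swap12[OF pU, of "T p" e "J e"] C_swap23[OF pU, of "T p" e "J e"] e(2)
    by (simp add: h_simps[OF pU] hee algebra_simps)
  have 4: "C p e (\<nu> p) e = (c + s) * h p (\<nu> p) (\<nu> p) - (c + s)\<^sup>2"
    using C_nu[OF p e(1,3)] e by simp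
  have 5: "C p (J e) (J e) (\<nu> p) = (c - s) * h p (\<nu> p) (\<nu> p) - (c - s)\<^sup>2"
    using C_nu[OF p Je] e C_swap23[OF pU, of "J e" "\<nu> p" "J e"] by simp
  \<comment> \<open>In the difference of the two equations \<open>Q\<close> and the terms with
    \<open>h (\<nu>, \<nu>)\<close> cancel. The rest is
    \<open>- 4 c s lam - 2 s (c^2 - s^2)\<close>, and \<open>c^2 - s^2 = c lam\<close>.\<close>
  have "6 * c * s * lam p = 0"
    using 1 2 s(1) unfolding 3 4 5 Q_swap12[OF pU, of "J e" e] by algebra
  then show ?thesis using c_nonzero s by simp
qed

section \<open>The cases \<open>lam = c\<close> and \<open>lam = 0\<close>\<close>

text \<open>On a tube this is the bilinear form of the orthogonal projection onto the real subspace
  spanned by all the normals, hence independent of \<open>x\<close>.\<close>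

definition tube_form :: "'a \<Rightarrow> 'a \<Rightarrow> 'a \<Rightarrow> real" where
  "tube_form w z x = h x (w - (w \<bullet> \<nu> x) *\<^sub>R \<nu> x) (z - (z \<bullet> \<nu> x) *\<^sub>R \<nu> x) / (2 * c)
    + (w \<bullet> \<nu> x) * (z \<bullet> \<nu> x)"

text \<open>For \<open>lam = c\<close> the symmetric operator \<open>A - c\<close> has square zero
  on \<open>H\<close>, hence vanishes there; on \<open>T\<close> the claim is
  \<open>A_T\<close>.\<close>

lemma A_umbilical:
  assumes p: "p \<in> M \<inter> U" and v: "\<nu> p \<bullet> v = 0" and lam: "lam p = c"
  shows "A p v = c *\<^sub>R v"
proof -
  have pU: "p \<in> U" using p by auto
  obtain w a where w: "w \<in> H p" "v = w + a *\<^sub>R T p"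
    using tangent_split[OF p v] .
  have "(A p w - c *\<^sub>R w) \<bullet> (A p w - c *\<^sub>R w) = 0"
    using A_sq[OF p w(1) w(1)] lam
    by (simp add: inner_diff_left inner_diff_right A_inner[OF pU] h_simps[OF pU] algebra_simps)
  then have "A p w = c *\<^sub>R w"
    by (subst (asm) inner_eq_zero_iff) simp
  then show ?thesis
    using A_T[OF p] lam by (simp add: w(2) A_simps[OF pU] algebra_simps)
qed

lemma A_tangent:
  assumes p: "p \<in> M \<inter> U" and v: "\<nu> p \<bullet> v = 0"
  shows "\<nu> p \<bullet> A p v = 0"
  using p h_nu(1)[OF p v] by (auto simp: A_inner)

lemma A_sq_tube:
  assumes p: "p \<in> M \<inter> U" and v: "\<nu> p \<bullet> v = 0" and lam: "lam p = 0"
  shows "A p (A p v) = (2 * c) *\<^sub>R A p v"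
proof -
  have pU: "p \<in> U" using p by auto
  obtain w a where w: "w \<in> H p" "v = w + a *\<^sub>R T p"
    using tangent_split[OF p v] .
  show ?thesis
    using A_T[OF p] A_A[OF p w(1)] lam by (simp add: w(2) A_simps[OF pU])
qed

lemma C_tangent_tube:
  assumes p: "p \<in> M \<inter> U" and lam: "lam p = 0"
    and t: "\<nu> p \<bullet> u = 0" "\<nu> p \<bullet> v = 0" "\<nu> p \<bullet> w = 0"
  shows "C p u v w = 0"
proof -
  have pU: "p \<in> U" using p by auto
  obtain u' a where u: "u' \<in> H p" "u = u' + a *\<^sub>R T p" using tangent_split[OF p t(1)] .
  obtain v' b where v: "v' \<in> H p" "v = v' + b *\<^sub>R T p" using tangent_split[OF p t(2)] .
  obtain w' d where w: "w' \<in> H p" "w = w' + d *\<^sub>R T p" using tangent_split[OF p t(3)] .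
  have 1: "C p x (T p) y = 0" "C p (T p) x y = 0" "C p x y (T p) = 0" if "x \<in> H p" "y \<in> H p" for x y
    using C_HTH[OF p that(2,1)] lam C_swap12[OF pU] C_swap23[OF pU] by simp_all
  have 2: "C p (T p) (T p) x = 0" "C p (T p) x (T p) = 0" "C p x (T p) (T p) = 0" if "x \<in> H p" for x
    using C_TTH[OF p that] C_swap12[OF pU] C_swap23[OF pU] by metis+
  have "C p u' v' w' = 0"
    using C_HHH[OF p _ u(1) v(1) w(1)] lam c_nonzero by simp
  then show ?thesis
    using 1 2 C_TTT[OF p] u(1) v(1) w(1)
    by (simp add: u(2) v(2) w(2) C_simps[OF pU])
qed

text \<open>\<open>C\<close> vanishes on tangent vectors, so only the motion of the tangential parts
  and of \<open>\<nu>\<close> contributes. By \<open>A (A v) = 2 c A v\<close> the former gives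
  \<open>2 c\<close> times what the latter gives, with opposite sign; the division by
  \<open>2 c\<close> balances them.\<close>

lemma along_tube_form:
  assumes p: "p \<in> M \<inter> U" and lam: "lam p = 0" and v: "\<nu> p \<bullet> v = 0"
  shows "along p v (tube_form w z) 0"
proof -
  have pU: "p \<in> U" using p by auto
  define \<pi> where "\<pi> w x = w - (w \<bullet> \<nu> x) *\<^sub>R \<nu> x" for w x
  define \<pi>' where "\<pi>' w = - ((w \<bullet> \<nu> p) *\<^sub>R A p v + (w \<bullet> A p v) *\<^sub>R \<nu> p)" for w
  have w: "along p v (\<lambda>x. w \<bullet> \<nu> x) (w \<bullet> A p v)" for w
    using along_inner[OF deriv_along_const along_nu[OF p]] by simp
  have \<pi>: "along p v (\<pi> w) (\<pi>' w)" for w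
    using deriv_along_diff[OF deriv_along_const along_scaleR[OF w along_nu[OF p]], of w w]
    by (simp add: \<pi>_def[abs_def] \<pi>'_def)
  have t: "\<nu> p \<bullet> \<pi> w p = 0" for w
    by (simp add: \<pi>_def inner_diff_right unit[OF p] inner_commute)
  have hA: "h p (A p v) (\<pi> z p) = 2 * c * (z \<bullet> A p v)" for z
  proof -
    have "h p (A p v) (\<pi> z p) = 2 * c * (A p v \<bullet> \<pi> z p)"
      using A_inner(1)[OF pU, of "A p v" "\<pi> z p"] A_sq_tube[OF p v lam] by simp
    then show ?thesis
      using A_tangent[OF p v] by (simp add: \<pi>_def inner_diff_right inner_commute)
  qed
  have h': "h p (\<pi>' w) (\<pi> z p) = - (w \<bullet> \<nu> p) * (2 * c * (z \<bullet> A p v))"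
    "h p (\<pi> z p) (\<pi>' w) = - (w \<bullet> \<nu> p) * (2 * c * (z \<bullet> A p v))" for w z
    using hA[of z] h_nu[OF p t] h_sym[OF pU, of "\<pi> z p" "A p v"]
    by (simp_all add: \<pi>'_def h_simps[OF pU])
  have "along p v (\<lambda>x. (1 / (2 * c)) * h x (\<pi> w x) (\<pi> z x) + (w \<bullet> \<nu> x) * (z \<bullet> \<nu> x))
     ((1 / (2 * c)) * (C p v (\<pi> w p) (\<pi> z p) + h p (\<pi>' w) (\<pi> z p) + h p (\<pi> w p) (\<pi>' z))
       + 0 * h p (\<pi> w p) (\<pi> z p) + ((w \<bullet> \<nu> p) * (z \<bullet> A p v) + (w \<bullet> A p v) * (z \<bullet> \<nu> p)))"
    by (intro deriv_along_add along_mult deriv_along_const along_h[OF p \<pi> \<pi>] w)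
  moreover have "C p v (\<pi> w p) (\<pi> z p) = 0"
    by (rule C_tangent_tube[OF p lam v t t])
  moreover have "tube_form w z = (\<lambda>x. (1 / (2 * c)) * h x (\<pi> w x) (\<pi> z x) + (w \<bullet> \<nu> x) * (z \<bullet> \<nu> x))"
    by (simp add: tube_form_def \<pi>_def fun_eq_iff)
  ultimately show ?thesis
    using c_nonzero unfolding h' by (simp add: field_simps)
qed

definition tube_proj :: "'a \<Rightarrow> 'a \<Rightarrow> 'a" where
  "tube_proj x w = (1 / (2 * c)) *\<^sub>R A x (w - (w \<bullet> \<nu> x) *\<^sub>R \<nu> x) + (w \<bullet> \<nu> x) *\<^sub>R \<nu> x"

lemma tube_proj_inner:
  assumes p: "p \<in> M \<inter> U"
  shows "tube_proj p w \<bullet> z = tube_form w z p"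
proof -
  have pU: "p \<in> U" using p by auto
  have "\<nu> p \<bullet> (w - (w \<bullet> \<nu> p) *\<^sub>R \<nu> p) = 0"
    by (simp add: inner_diff_right unit[OF p] inner_commute)
  from h_nu(1)[OF p this] show ?thesis
    by (simp add: tube_proj_def tube_form_def inner_add_left A_inner(1)[OF pU] h_simps(6-10)[OF pU]
        linear_diff[OF h_linear[OF pU]] linear_cmul[OF h_linear[OF pU]] inner_commute[of "\<nu> p" z])
qed

lemma tube_proj_sym:
  assumes p: "p \<in> M \<inter> U"
  shows "tube_proj p w \<bullet> z = w \<bullet> tube_proj p z"
  using p h_sym by (auto simp: tube_proj_inner inner_commute[of w] tube_form_def mult.commute)

lemma linear_tube_proj:
  assumes p: "p \<in> M \<inter> U"
  shows "linear (tube_proj p)"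
proof -
  have pU: "p \<in> U" using p by auto
  show ?thesis
    by (rule linearI)
      (simp_all add: tube_proj_def inner_add_left A_simps[OF pU] algebra_simps)
qed

lemma tube_proj_tangent: "\<nu> p \<bullet> v = 0 \<Longrightarrow> tube_proj p v = (1 / (2 * c)) *\<^sub>R A p v"
  by (simp add: tube_proj_def inner_commute)

lemma tube_proj_nu:
  assumes p: "p \<in> M \<inter> U"
  shows "tube_proj p (\<nu> p) = \<nu> p"
  using p A_simps(5) by (auto simp: tube_proj_def unit)

lemma tube_proj_idem:
  assumes p: "p \<in> M \<inter> U" and lam: "lam p = 0"
  shows "tube_proj p (tube_proj p w) = tube_proj p w"
proof -
  have pU: "p \<in> U" using p by auto
  define v where "v = w - (w \<bullet> \<nu> p) *\<^sub>R \<nu> p"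
  have v: "\<nu> p \<bullet> v = 0"
    by (simp add: v_def inner_diff_right unit[OF p] inner_commute)
  have "tube_proj p (A p v) = A p v"
    using A_sq_tube[OF p v lam] c_nonzero by (simp add: tube_proj_tangent[OF A_tangent[OF p v]])
  moreover have "tube_proj p w = (1 / (2 * c)) *\<^sub>R A p v + (w \<bullet> \<nu> p) *\<^sub>R \<nu> p"
    by (simp add: tube_proj_def v_def)
  ultimately show ?thesis
    by (simp add: linear_add[OF linear_tube_proj[OF p]] linear_cmul[OF linear_tube_proj[OF p]]
        tube_proj_nu[OF p])
qed

text \<open>On \<open>H\<close> this is the anticommutation of \<open>A - c\<close> with
  \<open>J\<close>; besides, \<open>\<nu> p\<close> is fixed and \<open>T p\<close> is annihilated.
  Thus \<open>J\<close> exchanges range and kernel, which will make the range totally real of half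
  the dimension.\<close>

lemma tube_proj_J:
  assumes p: "p \<in> M \<inter> U" and lam: "lam p = 0"
  shows "tube_proj p (J w) = J (w - tube_proj p w)"
proof -
  have pU: "p \<in> U" using p by auto
  note lin = linear_add[OF linear_tube_proj[OF p]] linear_cmul[OF linear_tube_proj[OF p]]
    linear_neg[OF linear_tube_proj[OF p]] linear_diff[OF linear_tube_proj[OF p]]
  have "\<nu> p \<bullet> (w - (w \<bullet> \<nu> p) *\<^sub>R \<nu> p) = 0"
    by (simp add: inner_diff_right unit[OF p] inner_commute)
  from tangent_split[OF p this] obtain X a where X: "X \<in> H p"
    "w - (w \<bullet> \<nu> p) *\<^sub>R \<nu> p = X + a *\<^sub>R T p" .
  then have w: "w = X + a *\<^sub>R T p + (w \<bullet> \<nu> p) *\<^sub>R \<nu> p"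
    by (simp add: algebra_simps)
  have "tube_proj p (T p) = 0"
    using A_T[OF p] lam by (simp add: tube_proj_tangent)
  moreover have "tube_proj p (J X) = J (X - tube_proj p X)"
    using A_J(2)[OF p X(1)] H_D(1)[OF X(1)] H_D(1)[OF H_J[OF X(1)]] c_nonzero
    by (simp add: tube_proj_tangent scaleR_diff_right)
  ultimately show ?thesis
    using tube_proj_nu[OF p] by (subst (1 2 3) w) (simp add: lin algebra_simps)
qed

end

section \<open>From charts to the hypersurface\<close>

text \<open>The gradient of \<open>r\<close> extends \<open>\<nu>\<close> from
  \<open>M \<inter> U\<close> to \<open>U\<close>, and in tangent directions the derivative within
  \<open>M\<close> is that of any extension.\<close>

lemma shape_operator_hessian:
  fixes M :: "(complex ^ 'm::finite) set" and r :: "complex ^ 'm \<Rightarrow> real"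
  assumes U: "open U" "p \<in> M \<inter> U" and r: "smooth_on U r"
    and grad: "\<forall>x\<in>M \<inter> U. \<forall>v. ddir v r x = \<nu> x \<bullet> v" and u: "u \<in> tangent_space M p"
  shows "frechet_derivative \<nu> (at p within M) u \<bullet> z = ddir u (ddir z r) p"
proof -
  have pU: "p \<in> U" using U by auto
  have "frechet_derivative \<nu> (at p within M) u = (\<Sum>b\<in>Basis. ddir u (ddir b r) p *\<^sub>R b)"
  proof (rule frechet_derivative_within_tangent[OF _ U(1) pU _ u])
    show "((\<lambda>x. \<Sum>b\<in>Basis. ddir b r x *\<^sub>R b) has_derivative
        (\<lambda>u. \<Sum>b\<in>Basis. ddir u (ddir b r) p *\<^sub>R b)) (at p)"
      by (intro has_derivative_sum has_derivative_scaleR_left has_derivative_ddir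
          smooth_onD(1)[OF smooth_onD(2)[OF r]] pU)
    show "\<forall>x\<in>U \<inter> M. (\<Sum>b\<in>Basis. ddir b r x *\<^sub>R b) = \<nu> x"
      using grad by (auto simp: euclidean_representation)
  qed
  also have "\<dots> \<bullet> z = (\<Sum>b\<in>Basis. (z \<bullet> b) *\<^sub>R ddir b (ddir u r) p)"
    using ddir_commute[OF r U(1) pU, of u]
    by (simp add: inner_sum_left inner_commute[of z] mult.commute)
  also have "\<dots> = ddir z (ddir u r) p"
    using linear_frechet_derivative_sum[OF smooth_onD(1)[OF smooth_onD(2)[OF r] pU]] by metis
  also have "\<dots> = ddir u (ddir z r) p"
    by (rule ddir_commute[OF r U(1) pU])
  finally show ?thesis .
qed

abbreviation imul :: "complex ^ 'm \<Rightarrow> complex ^ 'm::finite" where "imul x \<equiv> \<i> *s x"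

lemma linear_imul: "linear (imul :: complex ^ 'm \<Rightarrow> complex ^ 'm::finite)"
  by (rule linearI) (simp_all add: vec_eq_iff algebra_simps)

lemma imul_imul: "imul (imul x) = - x"
  by (simp add: vec_eq_iff)

lemma imul_inner: "imul x \<bullet> imul y = x \<bullet> y"
  by (simp add: inner_vec_def inner_complex_def add.commute)

lemma imul_inner_left: "imul x \<bullet> y = - (x \<bullet> imul y)"
  using imul_inner[of x "imul y"] by (simp add: imul_imul)

text \<open>The pair is \<open>X - i J X\<close>, twice the (1,0) part of \<open>X\<close>.\<close>

lemma holo_tangent_pair:
  "X \<in> tangent_space M p \<Longrightarrow> - imul X \<in> tangent_space M p \<Longrightarrow> (X, - imul X) \<in> holo_tangent M p"
  by (simp add: holo_tangent_def cplx_J_def cscale_def imul_imul linear_neg[OF linear_imul])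

text \<open>Umbilicity evaluated on \<open>Z = X - i J X\<close> and \<open>W = Y - i J Y\<close>
  and split into real and imaginary parts.\<close>

lemma levi_umbilical_hessian:
  fixes M :: "(complex ^ 'm::finite) set"
  assumes M: "embedded_hypersurface M" "smooth_unit_normal M \<nu>" and um: "levi_umbilical M \<nu>"
    and c: "\<forall>p\<in>M. levi_curvature M \<nu> p = c"
    and U: "open U" "p \<in> M \<inter> U" and r: "smooth_on U r"
    and grad: "\<forall>x\<in>M \<inter> U. \<forall>v. ddir v r x = \<nu> x \<bullet> v"
    and X: "\<nu> p \<bullet> X = 0" "imul (\<nu> p) \<bullet> X = 0" and Y: "\<nu> p \<bullet> Y = 0" "imul (\<nu> p) \<bullet> Y = 0"
  shows "Complex (ddir X (ddir Y r) p + ddir (imul X) (ddir (imul Y) r) p)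
      (ddir X (ddir (imul Y) r) p - ddir (imul X) (ddir Y r) p)
    = c * Complex (2 * (X \<bullet> Y)) (2 * (X \<bullet> imul Y))"
proof -
  have pU: "p \<in> U" and pM: "p \<in> M" using U by auto
  have ts: "tangent_space M p = {v. \<nu> p \<bullet> v = 0}"
    by (rule tangent_space_eq[OF M pM])
  have t: "X \<in> tangent_space M p" "imul X \<in> tangent_space M p" "- imul X \<in> tangent_space M p"
    "Y \<in> tangent_space M p" "imul Y \<in> tangent_space M p" "- imul Y \<in> tangent_space M p"
    using X Y imul_inner_left[of "\<nu> p" X] imul_inner_left[of "\<nu> p" Y] by (simp_all add: ts)
  define S where "S = frechet_derivative \<nu> (at p within M)"
  have S: "u \<bullet> S v = ddir u (ddir v r) p" if "v \<in> tangent_space M p" for u v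
    using shape_operator_hessian[OF U r grad that, of u] ddir_commute[OF r U(1) pU, of u v]
    by (simp add: S_def inner_commute)
  have "levi_form M \<nu> p (X, - imul X) (Y, - imul Y)
      = c * cmetric (X, - imul X) (cvec_cnj (Y, - imul Y))"
    using um[unfolded levi_umbilical_def, rule_format, OF pM holo_tangent_pair[OF t(1,3)] holo_tangent_pair[OF t(4,6)]]
      c pM by simp
  then show ?thesis
    using t by (simp add: levi_form_def second_fundamental_form_def D_along_def cmetric_def cvec_cnj_def
        S flip: S_def) (simp add: imul_inner imul_inner_left)
qed

lemma levi_chart_exists:
  fixes M :: "(complex ^ 'm::finite) set"
  assumes M: "embedded_hypersurface M" "smooth_unit_normal M \<nu>" and um: "levi_umbilical M \<nu>"
    and c: "c \<noteq> 0" "\<forall>p\<in>M. levi_curvature M \<nu> p = c" and card: "CARD('m) \<ge> 3" and p: "p \<in> M"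
  shows "\<exists>U r. p \<in> U \<and> levi_chart imul M U \<nu> r (Re c)"
proof -
  obtain U r where U: "open U" "p \<in> U" and r: "smooth_on U r"
    and grad: "\<And>x v. x \<in> M \<inter> U \<Longrightarrow> ddir v r x = \<nu> x \<bullet> v"
    by (rule hypersurface_normal_chart[OF M p]) (rule that)
  have dim: "DIM(complex ^ 'm) > 4" using card by simp
  have "\<forall>x\<in>M \<inter> U. \<forall>v. ddir v r x = \<nu> x \<bullet> v" using grad by blast
  note hess = levi_umbilical_hessian[OF M um c(2) U(1) _ r this]
  have pU: "p \<in> M \<inter> U" using p U by auto
  obtain X where X: "X \<noteq> 0" "\<And>y. y \<in> set [\<nu> p, imul (\<nu> p)] \<Longrightarrow> y \<bullet> X = 0"
    using orthogonal_to_list_exists[of "[\<nu> p, imul (\<nu> p)]"] dim by auto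
  \<comment> \<open>For \<open>Y = X\<close> the imaginary part of the Levi form vanishes by
    symmetry of the Hessian, and \<open>X \<bullet> J X = 0\<close>; so the constant is
    real.\<close>
  have "Im c * (2 * (X \<bullet> X)) = 0"
    using arg_cong[OF hess[OF pU, of X X], of Im] X(2)[of "\<nu> p"] X(2)[of "imul (\<nu> p)"]
      ddir_commute[OF r U, of X "imul X"] imul_inner_left[of X X]
    by (simp add: inner_commute[of "imul X"])
  then have "Im c = 0" using X(1) by simp
  have "levi_chart imul M U \<nu> r (Re c)"
  proof (rule levi_chart.intro)
    show "Re c \<noteq> 0" using c(1) \<open>Im c = 0\<close> by (simp add: complex_eq_iff)
    fix x assume x: "x \<in> M \<inter> U"
    then have xM: "x \<in> M" by auto
    show "\<nu> x \<bullet> \<nu> x = 1"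
      using M(2) xM by (auto simp: smooth_unit_normal_def dot_square_norm)
    show "v \<in> tangent_space M x" if "\<nu> x \<bullet> v = 0" for v
      using that tangent_space_eq[OF M xM] by simp
    show "ddir X (ddir Y r) x + ddir (imul X) (ddir (imul Y) r) x = 2 * Re c * (X \<bullet> Y)"
      if "\<nu> x \<bullet> X = 0" "imul (\<nu> x) \<bullet> X = 0" "\<nu> x \<bullet> Y = 0" "imul (\<nu> x) \<bullet> Y = 0" for X Y
      using arg_cong[OF hess[OF x that], of Re] \<open>Im c = 0\<close> by simp
  qed (use linear_imul imul_imul imul_inner dim U r grad in auto)
  then show ?thesis using U by blast
qed

text \<open>\<open>lam\<close> and \<open>tube_form\<close> live in a chart and refer to its
  \<open>r\<close>. Written through the shape operator \<open>S\<close> they become the functions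
  \<open>Lam\<close> and \<open>\<beta>\<close> on all of \<open>M\<close>, to which connectedness
  applies; the charts only show that their derivatives vanish.\<close>

lemma levi_chart_dichotomy:
  fixes M :: "'a::euclidean_space set"
  assumes M: "embedded_hypersurface M" "connected M" "smooth_unit_normal M \<nu>" "p0 \<in> M"
    and ex_chart: "\<forall>p\<in>M. \<exists>U r. p \<in> U \<and> levi_chart J M U \<nu> r c"
    and hessian: "\<forall>U r. levi_chart J M U \<nu> r c \<longrightarrow>
      (\<forall>p\<in>M \<inter> U. \<forall>u z. \<nu> p \<bullet> u = 0 \<longrightarrow> S p u \<bullet> z = ddir u (ddir z r) p)"
  shows "(\<exists>k. \<forall>x\<in>M. \<nu> x = c *\<^sub>R x + k) \<or>
    (\<exists>P k. linear P \<and> (\<forall>w. P (P w) = P w) \<and> (\<forall>w z. P w \<bullet> z = w \<bullet> P z) \<and>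
      (\<forall>w. P (J w) = J (w - P w)) \<and> (\<forall>x\<in>M. P (\<nu> x) = \<nu> x) \<and> (\<forall>x\<in>M. \<nu> x = (2 * c) *\<^sub>R P x + k))"
proof -
  note chart = ex_chart[rule_format] and shape = hessian[rule_format]
  define Lam where "Lam x = S x (J (\<nu> x)) \<bullet> J (\<nu> x)" for x
  have Lam: "Lam x = levi_chart.lam J \<nu> r x" if "levi_chart J M U \<nu> r c" "x \<in> M \<inter> U" for x U r
  proof -
    interpret levi_chart J M U \<nu> r c by fact
    show ?thesis
      using shape[OF that(1,2) nu_T(1), of "T x"] by (simp add: Lam_def levi_chart.lam_def[OF that(1)] h_def)
  qed
  have "Lam constant_on M"
  proof (rule deriv_along_zero_imp_constant[OF M(1-3)])
    fix p v assume p: "p \<in> M" and v: "\<nu> p \<bullet> v = 0"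
    obtain U r where U: "p \<in> U" "levi_chart J M U \<nu> r c" using chart[OF p] by blast
    interpret levi_chart J M U \<nu> r c by fact
    have pU: "p \<in> M \<inter> U" using p U by auto
    show "deriv_along M p v Lam 0"
      by (rule deriv_along_cong[OF open_U U(1) _ along_lam[OF pU v]]) (rule Lam[OF U(2), symmetric])
  qed
  then have lam0: "Lam x = Lam p0" if "x \<in> M" for x
    using M(4) that by (metis constant_on_def)
  show ?thesis
  proof (cases "Lam p0 = c")
    case True
    have "(\<lambda>x. \<nu> x - c *\<^sub>R x) constant_on M"
    proof (rule deriv_along_zero_imp_constant[OF M(1-3)])
      fix p v assume p: "p \<in> M" and v: "\<nu> p \<bullet> v = 0"
      obtain U r where U: "p \<in> U" "levi_chart J M U \<nu> r c" using chart[OF p] by blast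
      interpret levi_chart J M U \<nu> r c by fact
      have pU: "p \<in> M \<inter> U" using p U by auto
      have "A p v = c *\<^sub>R v"
        using A_umbilical[OF pU v] Lam[OF U(2) pU] lam0[OF p] True by simp
      then show "deriv_along M p v (\<lambda>x. \<nu> x - c *\<^sub>R x) 0"
        using deriv_along_diff[OF along_nu[OF pU] deriv_along_linear[OF bounded_linear_scaleR_right deriv_along_ident], of v c]
        by simp
    qed
    then obtain k where "\<forall>x\<in>M. \<nu> x - c *\<^sub>R x = k"
      unfolding constant_on_def by blast
    then show ?thesis
      by (intro disjI1 exI[of _ k]) (auto simp: algebra_simps)
  next
    case False
    define \<beta> where "\<beta> w z x = S x (w - (w \<bullet> \<nu> x) *\<^sub>R \<nu> x) \<bullet> (z - (z \<bullet> \<nu> x) *\<^sub>R \<nu> x) / (2 * c)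
      + (w \<bullet> \<nu> x) * (z \<bullet> \<nu> x)" for w z x
    have \<beta>: "\<beta> w z x = levi_chart.tube_form \<nu> r c w z x" if "levi_chart J M U \<nu> r c" "x \<in> M \<inter> U" for w z x U r
    proof -
      interpret levi_chart J M U \<nu> r c by fact
      have "\<nu> x \<bullet> (w - (w \<bullet> \<nu> x) *\<^sub>R \<nu> x) = 0"
        using unit[OF that(2)] by (simp add: inner_diff_right inner_commute)
      from shape[OF that(1,2) this] show ?thesis
        by (simp add: \<beta>_def levi_chart.tube_form_def[OF that(1)] h_def)
    qed
    have Lam': "levi_chart.lam J \<nu> r x = 0" if "levi_chart J M U \<nu> r c" "x \<in> M \<inter> U" for x U r
    proof -
      interpret levi_chart J M U \<nu> r c by fact
      have "levi_chart.lam J \<nu> r y \<noteq> c" if "y \<in> M \<inter> U" for y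
        using Lam[OF \<open>levi_chart J M U \<nu> r c\<close> that] lam0 that False by auto
      from lam_eq_0[OF that(2) this] show ?thesis .
    qed
    have "\<beta> w z constant_on M" for w z
    proof (rule deriv_along_zero_imp_constant[OF M(1-3)])
      fix p v assume p: "p \<in> M" and v: "\<nu> p \<bullet> v = 0"
      obtain U r where U: "p \<in> U" "levi_chart J M U \<nu> r c" using chart[OF p] by blast
      interpret levi_chart J M U \<nu> r c by fact
      have pU: "p \<in> M \<inter> U" using p U by auto
      show "deriv_along M p v (\<beta> w z) 0"
        by (rule deriv_along_cong[OF open_U U(1) _ along_tube_form[OF pU Lam'[OF U(2) pU] v]])
          (rule \<beta>[OF U(2), symmetric])
    qed
    then have \<beta>0: "\<beta> w z x = \<beta> w z p0" if "x \<in> M" for w z x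
      using M(4) that by (metis constant_on_def)
    obtain U r where U: "p0 \<in> U" "levi_chart J M U \<nu> r c" using chart[OF M(4)] by blast
    interpret p0: levi_chart J M U \<nu> r c by fact
    have p0: "p0 \<in> M \<inter> U" using M(4) U by auto
    define P where "P = p0.tube_proj p0"
    \<comment> \<open>An operator is determined by its bilinear form, and the form is constant on
      \<open>M\<close>; so every chart and every point yields the same projection.\<close>
    have P: "levi_chart.tube_proj \<nu> r' c x = P" if U': "levi_chart J M U' \<nu> r' c" "x \<in> M \<inter> U'" for x U' r'
    proof (rule ext, rule vector_eq_rdot[THEN iffD1], intro allI)
      fix w z
      interpret levi_chart J M U' \<nu> r' c by fact
      show "levi_chart.tube_proj \<nu> r' c x w \<bullet> z = P w \<bullet> z"
        using tube_proj_inner[OF U'(2)] p0.tube_proj_inner[OF p0] \<beta>[OF U'] \<beta>[OF U(2) p0] \<beta>0[of x] U'(2)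
        by (simp add: P_def)
    qed
    have lin: "linear P"
      unfolding P_def by (rule p0.linear_tube_proj[OF p0])
    have "(\<lambda>x. \<nu> x - (2 * c) *\<^sub>R P x) constant_on M"
    proof (rule deriv_along_zero_imp_constant[OF M(1-3)])
      fix p v assume p: "p \<in> M" and v: "\<nu> p \<bullet> v = 0"
      obtain U' r' where U': "p \<in> U'" "levi_chart J M U' \<nu> r' c" using chart[OF p] by blast
      interpret levi_chart J M U' \<nu> r' c by fact
      have pU': "p \<in> M \<inter> U'" using p U' by auto
      have "P v = (1 / (2 * c)) *\<^sub>R A p v"
        using P[OF U'(2) pU'] tube_proj_tangent[OF v] by simp
      then have "A p v - (2 * c) *\<^sub>R P v = 0"
        using c_nonzero by simp
      moreover have "bounded_linear (\<lambda>x. (2 * c) *\<^sub>R P x)"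
        using lin bounded_linear_compose[OF bounded_linear_scaleR_right]
        by (simp add: linear_conv_bounded_linear)
      ultimately show "deriv_along M p v (\<lambda>x. \<nu> x - (2 * c) *\<^sub>R P x) 0"
        using deriv_along_diff[OF along_nu[OF pU'] deriv_along_linear[OF _ deriv_along_ident], of "\<lambda>x. (2 * c) *\<^sub>R P x" v]
        by simp
    qed
    then obtain k where k: "\<forall>x\<in>M. \<nu> x - (2 * c) *\<^sub>R P x = k"
      unfolding constant_on_def by blast
    have "P (\<nu> x) = \<nu> x" if x: "x \<in> M" for x
    proof -
      obtain U' r' where U': "x \<in> U'" "levi_chart J M U' \<nu> r' c" using chart[OF x] by blast
      interpret levi_chart J M U' \<nu> r' c by fact
      show ?thesis
        using tube_proj_nu[of x] P[OF U'(2), of x] U' x by simp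
    qed
    moreover have "P (P w) = P w" "P w \<bullet> z = w \<bullet> P z" "P (J w) = J (w - P w)" for w z
      unfolding P_def using p0.tube_proj_idem[OF p0 Lam'[OF U(2) p0]] p0.tube_proj_sym[OF p0]
        p0.tube_proj_J[OF p0 Lam'[OF U(2) p0]] by blast+
    moreover have "\<forall>x\<in>M. \<nu> x = (2 * c) *\<^sub>R P x + k"
      using k by (auto simp: algebra_simps)
    ultimately show ?thesis
      using lin by (intro disjI2 exI[of _ P] exI[of _ k]) blast
  qed
qed

section \<open>Totally real subspaces and spherical tubes\<close>

lemma dim_totally_real:
  fixes P :: "complex ^ 'm \<Rightarrow> complex ^ 'm::finite"
  assumes P: "linear P" "\<And>w. P (P w) = P w" "\<And>w z. P w \<bullet> z = w \<bullet> P z"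
    and J: "\<And>w. P (imul w) = imul (w - P w)"
  shows "dim (range P) = CARD('m)"
    and "\<And>x y. x \<in> range P \<Longrightarrow> y \<in> range P \<Longrightarrow> x \<bullet> imul y = 0"
proof -
  \<comment> \<open>For \<open>y\<close> in the range, \<open>P (J y) = J (y - P y) = 0\<close>:
    \<open>J y\<close> lies in the kernel of a symmetric projection, orthogonal to its
    range.\<close>
  show perp: "x \<bullet> imul y = 0" if "x \<in> range P" "y \<in> range P" for x y
    using that P(2,3) J by auto
  have inj: "inj imul"
    by (rule injI) (metis imul_imul minus_equation_iff)
  have "w \<in> span (range P \<union> imul ` range P)" for w
  proof -
    \<comment> \<open>The kernel is the image of the range under \<open>J\<close>, so the whole
      space is their orthogonal sum and the range has half the real dimension.\<close>
    have "w - P w = imul (P (- imul w))"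
      by (simp add: linear_neg[OF P(1)] J linear_neg[OF linear_imul] imul_imul linear_diff[OF linear_imul])
    then have "w = P w + imul (P (- imul w))"
      by (metis add_diff_cancel_left' diff_add_cancel add.commute)
    then show ?thesis
      by (metis (no_types, lifting) UnI1 UnI2 imageI rangeI span_add span_base)
  qed
  then have "dim (range P \<union> imul ` range P) = DIM(complex ^ 'm)"
    by (metis dim_UNIV dim_span UNIV_eq_I)
  moreover have "dim (range P \<union> imul ` range P) = dim (range P) + dim (imul ` range P)"
    by (rule dim_orthogonal_sum) (use perp in auto)
  moreover have "dim (imul ` range P) = dim (range P)"
    by (rule dim_image_eq[OF linear_imul]) (use inj in \<open>auto intro: inj_on_subset\<close>)
  ultimately show "dim (range P) = CARD('m)" by simp
qed

text \<open>The unitary matrix has an orthonormal basis of the totally real subspace \<open>range P\<close> as columns.\<close>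

lemma spherical_tube_of_projection:
  fixes P :: "complex ^ 'm \<Rightarrow> complex ^ 'm::finite"
  assumes P: "linear P" "\<And>w. P (P w) = P w" "\<And>w z. P w \<bullet> z = w \<bullet> P z"
    and J: "\<And>w. P (imul w) = imul (w - P w)" and R: "R > 0"
  obtains T where "spherical_tube_boundary T" "{x. norm (P (x - b)) = R} \<subseteq> T"
proof -
  have sub: "subspace (range P)"
    by (rule linear_subspace_image[OF P(1) subspace_UNIV])
  obtain B where B: "B \<subseteq> range P" "pairwise orthogonal B" "\<And>x. x \<in> B \<Longrightarrow> norm x = 1"
    "independent B" "card B = dim (range P)" "span B = range P"
    by (rule orthonormal_basis_subspace[OF sub]) (rule that)
  have fin: "finite B" using B(4) by (rule independent_imp_finite)
  have "card (UNIV :: 'm set) = card B"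
    using dim_totally_real(1)[OF P J] B(5) by simp
  then obtain e :: "'m \<Rightarrow> complex ^ 'm" where e: "bij_betw e UNIV B"
    using finite_same_card_bij[OF finite_class.finite_UNIV fin] by blast
  have eB: "e h \<in> B" for h using e by (auto simp: bij_betw_def)
  \<comment> \<open>The real part of the hermitian product is the Euclidean one; the imaginary part
    vanishes because the range is totally real. So a real orthonormal basis is a unitary
    one.\<close>
  have herm: "(\<Sum>i\<in>UNIV. cnj (e h $ i) * e k $ i) = (if h = k then 1 else 0)" for h k
  proof -
    have "e h \<bullet> e k = (if h = k then 1 else 0)"
    proof (cases "h = k")
      case True
      then show ?thesis using B(3)[OF eB[of k]] by (simp add: dot_square_norm)
    next
      case False
      then have "e h \<noteq> e k" using e by (auto simp: bij_betw_def inj_on_def)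
      then show ?thesis using B(2) eB False by (auto simp: pairwise_def orthogonal_def)
    qed
    moreover have "e k \<bullet> imul (e h) = 0"
      by (rule dim_totally_real(2)[OF P J]) (use eB B(1) in auto)
    ultimately show ?thesis
      by (auto simp: complex_eq_iff inner_vec_def inner_complex_def algebra_simps sum_subtractf
          sum_negf sum.distrib)
  qed
  define V :: "complex ^ 'm ^ 'm" where "V = (\<chi> i h. e h $ i)"
  let ?V' = "\<chi> i j. cnj (V $ j $ i)"
  have "?V' ** V = mat 1"
    by (simp add: vec_eq_iff matrix_matrix_mult_def mat_def V_def herm)
  then have unitary: "unitary_matrix V"
    unfolding unitary_matrix_def using matrix_left_right_inverse[of V ?V'] by blast
  \<comment> \<open>The factor 2 arises from \<open>z + cnj z = 2 Re z\<close>.\<close>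
  define T where "T = (\<lambda>z. V *v z + b) `
    {z. (\<Sum>h\<in>UNIV. (z $ h + cnj (z $ h))\<^sup>2) = (complex_of_real (2 * R))\<^sup>2}"
  have "spherical_tube_boundary T"
    unfolding spherical_tube_boundary_def T_def using unitary R
    by (intro exI[of _ V] exI[of _ b] exI[of _ "2 * R"]) simp
  moreover have "x \<in> T" if x: "norm (P (x - b)) = R" for x
  proof -
    define z where "z = ?V' *v (x - b)"
    have "V *v z + b = x"
      using unitary unfolding unitary_matrix_def z_def
      by (simp add: matrix_vector_mul_assoc)
    moreover have "z $ h + cnj (z $ h) = complex_of_real (2 * (P (x - b) \<bullet> e h))" for h
    proof -
      \<comment> \<open>\<open>e h\<close> lies in the range of the symmetric projection, so its
        product with \<open>x - b\<close> sees only \<open>P (x - b)\<close>.\<close>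
      obtain y where "e h = P y" using eB[of h] B(1) by blast
      then have "P (x - b) \<bullet> e h = (x - b) \<bullet> e h"
        by (simp add: P(2,3))
      also have "\<dots> = Re (z $ h)"
        by (simp add: z_def V_def matrix_vector_mult_def inner_vec_def inner_complex_def mult.commute)
      finally show ?thesis by (simp add: complex_eq_iff)
    qed
    moreover have "(\<Sum>h\<in>UNIV. (P (x - b) \<bullet> e h)\<^sup>2) = R\<^sup>2"
    proof -
      let ?y = "P (x - b)"
      have "?y \<in> span B" using B(6) by blast
      then have "(\<Sum>i\<in>B. (?y \<bullet> i) *\<^sub>R i) = ?y"
        by (intro orthonormal_basis_expand B fin)
      then have "?y \<bullet> ?y = ?y \<bullet> (\<Sum>i\<in>B. (?y \<bullet> i) *\<^sub>R i)" by simp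
      also have "\<dots> = (\<Sum>i\<in>B. (?y \<bullet> i)\<^sup>2)"
        by (simp add: inner_sum_right power2_eq_square)
      also have "\<dots> = (\<Sum>h\<in>UNIV. (?y \<bullet> e h)\<^sup>2)"
        using sum.reindex_bij_betw[OF e, of "\<lambda>i. (?y \<bullet> i)\<^sup>2"] by simp
      finally show ?thesis using x by (simp add: dot_square_norm)
    qed
    then have "(\<Sum>h\<in>UNIV. (complex_of_real (2 * (P (x - b) \<bullet> e h)))\<^sup>2) = (complex_of_real (2 * R))\<^sup>2"
      by (simp add: power_mult_distrib flip: sum_distrib_left of_real_power of_real_sum)
    ultimately show ?thesis unfolding T_def by (intro image_eqI[of _ _ z]) auto
  qed
  ultimately show ?thesis using that by blast
qed

theorem theorem5p1:
  fixes M :: "(complex ^ 'm::finite) set"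
    and \<nu> :: "complex ^ 'm \<Rightarrow> complex ^ 'm"
    and n :: nat
    and c :: complex
  assumes "n \<ge> 2" and "CARD('m) = n + 1"
    and "embedded_hypersurface M" and "connected M"
    and "smooth_unit_normal M \<nu>"
    and "levi_umbilical M \<nu>"
    and "c \<noteq> 0" and "\<forall>p\<in>M. levi_curvature M \<nu> p = c"
  shows "(\<exists>a R. R > 0 \<and> M \<subseteq> sphere a R) \<or> (\<exists>T. spherical_tube_boundary T \<and> M \<subseteq> T)"
proof (cases "M = {}")
  case True
  then show ?thesis by (intro disjI1 exI[of _ 0] exI[of _ 1]) simp
next
  case False
  then obtain p0 where p0: "p0 \<in> M" by blast
  \<comment> \<open>\<open>levi_chart_exists\<close> shows along the way that \<open>c\<close> is
    real, so its real part is non-zero as well.\<close>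
  define a where "a = Re c"
  have chart: "\<forall>p\<in>M. \<exists>U r. p \<in> U \<and> levi_chart imul M U \<nu> r a"
    unfolding a_def using assms(1,2) by (intro ballI levi_chart_exists[OF assms(3,5,6,7,8)]) simp_all
  then have a: "a \<noteq> 0" using p0 levi_chart.c_nonzero by blast
  have unit: "norm (\<nu> x) = 1" if "x \<in> M" for x
    using assms(5) that by (simp add: smooth_unit_normal_def)
  have "\<forall>U r. levi_chart imul M U \<nu> r a \<longrightarrow> (\<forall>p\<in>M \<inter> U. \<forall>u z. \<nu> p \<bullet> u = 0 \<longrightarrow>
      frechet_derivative \<nu> (at p within M) u \<bullet> z = ddir u (ddir z r) p)"
  proof (intro allI impI ballI)
    fix U r p u z
    assume chart: "levi_chart imul M U \<nu> r a" and p: "p \<in> M \<inter> U" "\<nu> p \<bullet> u = 0"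
    interpret levi_chart imul M U \<nu> r a by fact
    show "frechet_derivative \<nu> (at p within M) u \<bullet> z = ddir u (ddir z r) p"
      using shape_operator_hessian[OF open_U p(1) smooth_r _ curve[OF p]] gradient by blast
  qed
  from levi_chart_dichotomy[OF assms(3,4,5) p0 chart this] show ?thesis
  proof (elim disjE exE conjE)
    fix k assume k: "\<forall>x\<in>M. \<nu> x = a *\<^sub>R x + k"
    \<comment> \<open>Solving \<open>\<nu> x = a x + k\<close> for \<open>x\<close> gives the centre
      \<open>- k / a\<close>; the modulus allows for either orientation.\<close>
    have "dist (- (1 / a) *\<^sub>R k) x = 1 / \<bar>a\<bar>" if "x \<in> M" for x
    proof -
      have "x - (- (1 / a) *\<^sub>R k) = (1 / a) *\<^sub>R \<nu> x"
        using k a that by (simp add: scaleR_add_right)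
      then show ?thesis
        using unit[OF that] by (simp add: dist_norm norm_minus_commute)
    qed
    then show ?thesis
      using a by (intro disjI1 exI[of _ "- (1 / a) *\<^sub>R k"] exI[of _ "1 / \<bar>a\<bar>"]) auto
  next
    fix P k
    assume P: "linear P" "\<forall>w. P (P w) = P w" "\<forall>w z. P w \<bullet> z = w \<bullet> P z"
      "\<forall>w. P (imul w) = imul (w - P w)" and P\<nu>: "\<forall>x\<in>M. P (\<nu> x) = \<nu> x"
      and k: "\<forall>x\<in>M. \<nu> x = (2 * a) *\<^sub>R P x + k"
    define b where "b = - (1 / (2 * a)) *\<^sub>R k"
    have "norm (P (x - b)) = 1 / (2 * \<bar>a\<bar>)" if x: "x \<in> M" for x
    proof -
      \<comment> \<open>Both \<open>\<nu> x\<close> and \<open>P x\<close> are fixed by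
        \<open>P\<close>, hence so is \<open>k\<close>, and it can be absorbed into the translation
        \<open>b\<close>.\<close>
      have "P ((2 * a) *\<^sub>R P x + k) = (2 * a) *\<^sub>R P x + k"
        using P\<nu> k x by metis
      then have "P k = k"
        using P(2) by (simp add: linear_add[OF P(1)] linear_cmul[OF P(1)])
      then have "P (x - b) = (1 / (2 * a)) *\<^sub>R \<nu> x"
        using k x a by (simp add: b_def linear_add[OF P(1)] linear_cmul[OF P(1)] scaleR_add_right)
      then show ?thesis using unit[OF x] by (simp add: abs_mult)
    qed
    moreover obtain T where "spherical_tube_boundary T" "{x. norm (P (x - b)) = 1 / (2 * \<bar>a\<bar>)} \<subseteq> T"
      using spherical_tube_of_projection[of P "1 / (2 * \<bar>a\<bar>)" b] P a by auto
    ultimately show ?thesis by blast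
  qed
qed

end
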